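(* Fix $R>2$ and let $\psi_R\in C^\infty(\mathbb{R}^2,[0,1])$ satisfy $\psi_R(\xi)=0$ for $|\xi|\le R$ and $\psi_R(\xi)=1$ for $|\xi|\ge R+1$. For $t>0$, $u\in\mathbb{C}$ let $$I_R=\int_{\mathbb{C}}|\xi|^{\alpha}\psi_R(\xi)e^{it\widetilde S(u,\xi)}\,d\,\mathrm{Re}\,\xi\,d\,\mathrm{Im}\,\xi,\qquad \widetilde S(u,\xi)=(\xi^3+\bar\xi^3)\Big(1-\frac{3}{\xi\bar\xi}\Big)+\frac12(\bar u\xi+u\bar\xi).$$ For any $0\le\alpha<1$ and any $\varepsilon>0$ small the following estimate is valid for all $t>0$: $$|I_R|\lesssim\frac{1}{t^{1-\varepsilon}},$$ uniformly in $u\in\mathbb{C}$. The implicit constant depends on $\alpha$, $\varepsilon$ and $R$ only.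
   Context: The integral $I_R$ is understood as an oscillatory integral. $\mathbb{C}$ is identified with $\mathbb{R}^2$. $A\lesssim B$ means $A\le cB$ for a constant $c>0$. The bump function $\psi_R$ is fixed once $R$ is fixed. The function $\widetilde S$ is the phase associated with the linearized Novikov–Veselov equation at energy $E=1$. *)

theory Defs
  imports "HOL-Analysis.Analysis"
begin

(* C^k on the whole space: all iterated directional derivatives up to order k exist,
   the lower ones are Frechet differentiable and those of order k are continuous. *)
primrec C_k :: "nat \<Rightarrow> ('a::real_normed_vector \<Rightarrow> 'b::real_normed_vector) \<Rightarrow> bool" where
  "C_k 0 f \<longleftrightarrow> continuous_on UNIV f"
| "C_k (Suc k) f \<longleftrightarrow>
     (\<forall>x. f differentiable (at x)) \<and> (\<forall>v. C_k k (\<lambda>x. frechet_derivative f (at x) v))"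

(* On type complex this is smoothness in the real sense (complex identified with R^2). *)
definition C_infinity :: "('a::real_normed_vector \<Rightarrow> 'b::real_normed_vector) \<Rightarrow> bool" where
  "C_infinity f \<longleftrightarrow> (\<forall>k. C_k k f)"

definition test_function :: "(complex \<Rightarrow> complex) \<Rightarrow> bool" where
  "test_function \<phi> \<longleftrightarrow> C_infinity \<phi> \<and> compact (closure {\<xi>. \<phi> \<xi> \<noteq> 0})"

(* Oscillatory integral over R^2: the limit of the absolutely convergent integrals with the
   regularising factor \<phi>(\<delta> \<xi>) as \<delta> tends to 0 from above, the limit being the
   same for every test function \<phi> with \<phi>(0) = 1. *)
definition has_oscillatory_integral :: "(complex \<Rightarrow> complex) \<Rightarrow> complex \<Rightarrow> bool" where
  "has_oscillatory_integral f I \<longleftrightarrow>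
     (\<forall>\<phi>. test_function \<phi> \<and> \<phi> 0 = 1 \<longrightarrow>
        (\<forall>\<delta>>0. integrable lborel (\<lambda>\<xi>. f \<xi> * \<phi> (\<delta> *\<^sub>R \<xi>))) \<and>
        ((\<lambda>\<delta>. LINT \<xi>|lborel. f \<xi> * \<phi> (\<delta> *\<^sub>R \<xi>)) \<longlongrightarrow> I) (at_right 0))"

definition oscillatory_integrable :: "(complex \<Rightarrow> complex) \<Rightarrow> bool" where
  "oscillatory_integrable f \<longleftrightarrow> (\<exists>I. has_oscillatory_integral f I)"

definition oscillatory_integral :: "(complex \<Rightarrow> complex) \<Rightarrow> complex" where
  "oscillatory_integral f = (THE I. has_oscillatory_integral f I)"

(* Real-valued for all u and \<xi>. The junk value at \<xi> = 0 is irrelevant below: the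
   cutoff \<psi> vanishes there. *)
definition S_tilde :: "complex \<Rightarrow> complex \<Rightarrow> complex" where
  "S_tilde u \<xi> =
     (\<xi> ^ 3 + cnj \<xi> ^ 3) * (1 - 3 / (\<xi> * cnj \<xi>)) + (1 / 2) * (cnj u * \<xi> + u * cnj \<xi>)"

definition integrand_I ::
    "(complex \<Rightarrow> real) \<Rightarrow> real \<Rightarrow> real \<Rightarrow> complex \<Rightarrow> complex \<Rightarrow> complex" where
  "integrand_I \<psi> \<alpha> t u \<xi> =
     of_real (norm \<xi> powr \<alpha> * \<psi> \<xi>) * exp (\<i> * of_real t * S_tilde u \<xi>)"

end

theory Submission
  imports Defs
begin

text \<open>
  Write \<open>p = \<partial>S/\<partial>\<xi>\<close> and \<open>Q = 1/t + |p|\<^sup>2\<close>. Integrating by parts along the bounded vector field \<open>\<nabla>S / Q\<close>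
  requires no cutoff around the critical points, and bounds \<open>t |I|\<close> by the integral over \<open>|\<xi>| \<ge> R\<close>
  of \<open>(|\<xi>|\<^sup>\<alpha>\<^sup>-\<^sup>1 |p| + |\<xi>|\<^sup>\<alpha>\<^sup>+\<^sup>1) / Q\<close>.

  The condition \<open>R > 2\<close> makes \<open>p\<close> expanding: the part of \<open>p\<close> which is not a polynomial depends only on the
  direction of \<open>\<xi>\<close>, so in a narrow sector \<open>|p(x) - p(y)| \<ge> c |x| |x - y|\<close>. Comparing with a point \<open>z\<close>
  at which \<open>|p|\<close> is nearly minimal on the sector gives \<open>|p(x)| \<ge> c |x| |x - z|\<close>, where \<open>u\<close> enters only
  through \<open>z\<close>. Since \<open>Q \<ge> t\<^sup>-\<^sup>\<epsilon> |p|\<^sup>2\<^sup>-\<^sup>2\<^sup>\<epsilon>\<close>, the integral is at most a constant times \<open>t\<^sup>\<epsilon>\<close>,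
  provided that \<open>\<epsilon> < (1 - \<alpha>) / 4\<close>.
\<close>

section \<open>Integrals over Euclidean space\<close>

text \<open>Where \<open>f\<close> is positive it is at most one term of the series of weighted ball
  indicators, and that series integrates to the given sum times the volume of the unit ball. This
  takes the place of polar coordinates in the two power integrals that follow.\<close>

lemma nn_integral_finite_of_ball_cover:
  fixes f :: "'a::euclidean_space \<Rightarrow> real" and c r :: "nat \<Rightarrow> real"
  assumes cover: "\<And>x. 0 < f x \<Longrightarrow> \<exists>k. norm x \<le> r k \<and> f x \<le> c k"
    and c: "\<And>k. 0 \<le> c k" and r: "\<And>k. 0 \<le> r k"
    and sm: "summable (\<lambda>k. c k * r k ^ DIM('a))"
  shows "(\<integral>\<^sup>+x. ennreal (f x) \<partial>lborel) < \<infinity>"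
proof -
  let ?V = "unit_ball_vol (real DIM('a))"
  have "ennreal (f x) \<le> (\<Sum>k. ennreal (c k) * indicator (cball 0 (r k)) x)" for x
  proof (cases "0 < f x")
    case True
    then obtain k where k: "norm x \<le> r k" "f x \<le> c k" using cover by blast
    have "ennreal (f x) \<le> ennreal (c k) * indicator (cball 0 (r k)) x"
      using k by (auto intro: ennreal_leI)
    also have "\<dots> \<le> (\<Sum>k. ennreal (c k) * indicator (cball 0 (r k)) x)"
      using sum_le_suminf[of "\<lambda>k. ennreal (c k) * indicator (cball 0 (r k)) x" "{k}"]
      by (simp del: sum_mult_indicator)
    finally show ?thesis .
  qed (simp add: ennreal_neg)
  hence "(\<integral>\<^sup>+x. ennreal (f x) \<partial>lborel)
      \<le> (\<integral>\<^sup>+x. (\<Sum>k. ennreal (c k) * indicator (cball 0 (r k)) (x::'a)) \<partial>lborel)"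
    by (intro nn_integral_mono)
  also have "\<dots> = (\<Sum>k. \<integral>\<^sup>+x. ennreal (c k) * indicator (cball 0 (r k)) (x::'a) \<partial>lborel)"
    by (intro nn_integral_suminf borel_measurable_times_ennreal borel_measurable_indicator) auto
  also have "\<dots> = (\<Sum>k. ennreal (?V * (c k * r k ^ DIM('a))))"
    using c r by (intro suminf_cong)
      (simp add: nn_integral_cmult_indicator emeasure_cball ennreal_mult'[symmetric] ac_simps)
  also have "\<dots> = ennreal (\<Sum>k. ?V * (c k * r k ^ DIM('a)))"
    using c r sm by (intro suminf_ennreal2 summable_mult) auto
  finally show ?thesis by (simp add: order_le_less_trans)
qed

text \<open>On the dyadic shell between radii 2^k and 2^(k+1) the integrand is at most 2^(-sk), so
  the series of the ball cover is geometric with ratio 2^(n-s), n being the dimension.\<close>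

lemma nn_integral_powr_norm_at_infinity:
  fixes s :: real
  assumes "s > DIM('a)"
  shows "(\<integral>\<^sup>+(x::'a::euclidean_space). ennreal (indicator {x. norm x \<ge> 1} x * norm x powr (-s)) \<partial>lborel) < \<infinity>"
proof (rule nn_integral_finite_of_ball_cover[where c = "\<lambda>k. (2 powr (-s)) ^ k" and r = "\<lambda>k. 2 ^ Suc k"])
  fix x :: 'a
  assume "0 < indicator {x. norm x \<ge> 1} x * norm x powr (-s)"
  hence x: "norm x \<ge> 1" by (auto simp: indicator_def of_bool_def split: if_splits)
  show "\<exists>k. norm x \<le> 2 ^ Suc k \<and> indicator {x. norm x \<ge> 1} x * norm x powr (-s) \<le> (2 powr (-s)) ^ k"
  proof -
    define k where "k = nat \<lfloor>log 2 (norm x)\<rfloor>"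
    have "0 \<le> log 2 (norm x)"
      using x by (subst zero_le_log_cancel_iff) auto
    hence k: "real k \<le> log 2 (norm x)" "log 2 (norm x) < real k + 1"
      unfolding k_def by linarith+
    have "norm x = 2 powr (log 2 (norm x))" using x by (subst powr_log_cancel) auto
    hence "2 powr real k \<le> norm x" "norm x \<le> 2 powr (real k + 1)"
      using k by (metis powr_mono one_le_numeral, metis powr_mono less_imp_le one_le_numeral)
    moreover from this have "norm x powr (-s) \<le> (2 powr real k) powr (-s)"
      using assms by (intro powr_mono2') auto
    moreover have "(2 powr real k) powr (-s) = (2 powr (-s)) ^ k"
      by (simp add: powr_powr powr_realpow[symmetric] mult.commute)
    moreover have "2 powr (real k + 1) = (2::real) ^ Suc k"
      by (simp add: powr_add powr_realpow)
    ultimately show ?thesis using x by auto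
  qed
next
  have "summable (\<lambda>k. 2 ^ DIM('a) * (2 powr (real DIM('a) - s)) ^ k)"
    using assms by (intro summable_mult summable_geometric) (simp add: powr_less_one)
  moreover have "2 ^ DIM('a) * (2 powr (real DIM('a) - s)) ^ k
      = (2 powr (-s)) ^ k * (2 ^ Suc k) ^ DIM('a)" for k
    by (simp add: powr_realpow[symmetric] powr_powr powr_add[symmetric] algebra_simps)
  ultimately show "summable (\<lambda>k. (2 powr (-s)) ^ k * (2 ^ Suc k) ^ DIM('a))" by simp
qed auto

text \<open>Dyadic shells now shrink to the origin: between radii 2^(-k-1) and 2^(-k) the integrand
  is at most 2^(q(k+1)), which gives a geometric series with ratio 2^(q-n).\<close>

lemma nn_integral_powr_norm_at_zero:
  fixes q :: real
  assumes "0 \<le> q" "q < DIM('a)"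
  shows "(\<integral>\<^sup>+(x::'a::euclidean_space). ennreal (indicator {x. norm x \<le> 1} x * norm x powr (-q)) \<partial>lborel) < \<infinity>"
proof (rule nn_integral_finite_of_ball_cover[where c = "\<lambda>k. (2 powr q) ^ Suc k" and r = "\<lambda>k. inverse 2 ^ k"])
  fix x :: 'a
  assume "0 < indicator {x. norm x \<le> 1} x * norm x powr (-q)"
  hence x: "norm x \<le> 1" by (auto simp: indicator_def of_bool_def split: if_splits)
  have "\<exists>k. norm x \<le> inverse 2 ^ k \<and> norm x powr (-q) \<le> (2 powr q) ^ Suc k"
  proof (cases "x = 0")
    case False
    define k where "k = nat \<lfloor>- log 2 (norm x)\<rfloor>"
    have "0 \<le> - log 2 (norm x)" using x False by simp
    hence k: "real k \<le> - log 2 (norm x)" "- log 2 (norm x) < real k + 1"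
      unfolding k_def by linarith+
    hence k': "log 2 (norm x) \<le> - real k" "- real (Suc k) \<le> log 2 (norm x)" by auto
    have "norm x = 2 powr (log 2 (norm x))" using False by (subst powr_log_cancel) auto
    hence *: "2 powr (- real (Suc k)) \<le> norm x" "norm x \<le> 2 powr (- real k)"
      using k' by (metis powr_mono one_le_numeral)+
    have "norm x powr (-q) \<le> (2 powr (- real (Suc k))) powr (-q)"
      using assms * by (intro powr_mono2') auto
    also have "\<dots> = (2 powr q) ^ Suc k"
      by (simp add: powr_powr powr_realpow[symmetric] algebra_simps del: power_Suc)
    finally have "norm x powr (-q) \<le> (2 powr q) ^ Suc k" .
    moreover have "2 powr (- real k) = (inverse 2::real) ^ k"
      by (simp add: powr_minus powr_realpow power_inverse inverse_eq_divide power_divide)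
    ultimately show ?thesis using * by auto
  \<comment> \<open>At the origin \<open>0 powr (-q)\<close> has the value 0, so any shell index
    serves.\<close>
  qed (auto intro!: exI[of _ 0])
  thus "\<exists>k. norm x \<le> inverse 2 ^ k \<and>
      indicator {x. norm x \<le> 1} x * norm x powr (-q) \<le> (2 powr q) ^ Suc k"
    using x by auto
next
  have "summable (\<lambda>k. 2 powr q * (2 powr (q - real DIM('a))) ^ k)"
    using assms by (intro summable_mult summable_geometric) (simp add: powr_less_one)
  moreover have "2 powr q * (2 powr (q - real DIM('a))) ^ k
      = (2 powr q) ^ Suc k * (inverse 2 ^ k) ^ DIM('a)" for k
  proof -
    have "(inverse 2 ^ k) ^ DIM('a) = (2::real) powr (- real (k * DIM('a)))"
      by (simp only: power_inverse powr_minus powr_realpow zero_less_numeral power_mult)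
    thus ?thesis
      by (simp only: powr_realpow[symmetric] powr_powr powr_add[symmetric] powr_gt_zero zero_neq_numeral simp_thms)
        (simp add: algebra_simps)
  qed
  ultimately show "summable (\<lambda>k. (2 powr q) ^ Suc k * (inverse 2 ^ k) ^ DIM('a))" by simp
qed auto

section \<open>Translation invariance and integrals of derivatives\<close>

lemma
  fixes f :: "'a::euclidean_space \<Rightarrow> 'b::{banach,second_countable_topology}"
  assumes "integrable lborel f"
  shows integrable_translate: "integrable lborel (\<lambda>x. f (c + x))"
    and integral_translate: "(LINT x|lborel. f (c + x)) = integral\<^sup>L lborel f"
proof -
  have [measurable]: "f \<in> borel_measurable borel"
    using borel_measurable_integrable[OF assms] by simp
  have "integrable (distr lborel borel ((+) c)) f"
    using assms by (simp add: lborel_distr_plus)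
  thus "integrable lborel (\<lambda>x. f (c + x))"
    by (subst (asm) integrable_distr_eq) auto
  have "integral\<^sup>L lborel f = integral\<^sup>L (distr lborel borel ((+) c)) f"
    by (simp add: lborel_distr_plus)
  also have "\<dots> = (LINT x|lborel. f (c + x))"
    by (subst integral_distr) auto
  finally show "(LINT x|lborel. f (c + x)) = integral\<^sup>L lborel f" by simp
qed

lemma integrable_continuous_bounded_support:
  fixes f :: "'a::euclidean_space \<Rightarrow> 'b::{banach,second_countable_topology}"
  assumes "continuous_on UNIV f" "\<And>x. norm x > r \<Longrightarrow> f x = 0"
  shows "integrable lborel f"
proof -
  have "integrable lborel (\<lambda>x. indicator (cball 0 r) x *\<^sub>R f x)"
    using borel_integrable_compact[OF compact_cball continuous_on_subset[OF assms(1)]]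
    by (simp add: set_integrable_def)
  moreover have "(\<lambda>x. indicator (cball 0 r) x *\<^sub>R f x) = f"
    using assms(2) by (auto simp: fun_eq_iff indicator_def not_le)
  ultimately show ?thesis by simp
qed

text \<open>The difference quotients integrate to 0 by translation invariance. The mean value
  inequality bounds them by \<open>M\<close> on a fixed ball, outside which they vanish, so
  dominated convergence passes to the derivative. It is applied to each component of a vector field
  and yields integration by parts without boundary terms.\<close>

lemma integral_directional_derivative_eq_0:
  fixes f :: "'a::euclidean_space \<Rightarrow> 'b::{banach,second_countable_topology}"
  assumes deriv: "\<And>x. (f has_derivative f' x) (at x)"
    and bound: "\<And>x. norm (f' x v) \<le> M"
    and supp: "\<And>x. norm x > r \<Longrightarrow> f x = 0"
  shows "integrable lborel (\<lambda>x. f' x v)" "(LINT x|lborel. f' x v) = 0"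
proof -
  define h where "h n = inverse (real (Suc n))" for n
  have h: "0 < h n" "h n \<le> 1" for n by (auto simp: h_def inverse_le_1_iff)
  define s where "s n x = (f (x + h n *\<^sub>R v) - f x) /\<^sub>R h n" for n x
  have cont: "continuous_on A f" for A
    using deriv by (auto intro!: continuous_at_imp_continuous_on has_derivative_continuous)
  have meas: "f \<in> borel_measurable borel"
    using cont by (rule borel_measurable_continuous_onI)
  have M: "0 \<le> M" using bound[of 0] norm_ge_zero order_trans by blast
  have int_f: "integrable lborel f"
    using cont supp by (rule integrable_continuous_bounded_support)
  have s_int: "integral\<^sup>L lborel (s n) = 0" for n
    using integrable_translate[OF int_f, of "h n *\<^sub>R v"] integral_translate[OF int_f, of "h n *\<^sub>R v"] int_f
    unfolding s_def
    by (simp add: add.commute del: integral_mult_right_zero)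
  have s_meas: "s n \<in> borel_measurable lborel" for n
    unfolding s_def using meas by measurable
  have lim: "(\<lambda>n. s n x) \<longlonglongrightarrow> f' x v" for x
  proof -
    have "((\<lambda>\<tau>. f (x + \<tau> *\<^sub>R v)) has_derivative (\<lambda>\<tau>. f' x (\<tau> *\<^sub>R v))) (at 0)"
      by (rule has_derivative_compose[where f="\<lambda>\<tau>. x + \<tau> *\<^sub>R v" and x=0, OF _ deriv[of "x + 0 *\<^sub>R v"], simplified])
        (auto intro!: derivative_eq_intros)
    hence "((\<lambda>\<tau>. f (x + \<tau> *\<^sub>R v)) has_vector_derivative f' x v) (at 0)"
      using linear_scale[OF has_derivative_linear[OF deriv]] by (simp add: has_vector_derivative_def)
    hence *: "((\<lambda>\<tau>. (f (x + \<tau> *\<^sub>R v) - f x) /\<^sub>R \<tau>) \<longlongrightarrow> f' x v) (at 0)"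
    proof -
      let ?e = "\<lambda>\<tau>. (1 / \<bar>\<tau>\<bar>) *\<^sub>R (f (x + \<tau> *\<^sub>R v) - (f x + \<tau> *\<^sub>R f' x v))"
      assume "((\<lambda>\<tau>. f (x + \<tau> *\<^sub>R v)) has_vector_derivative f' x v) (at 0)"
      hence "(?e \<longlongrightarrow> 0) (at 0)"
        by (simp add: has_vector_derivative_def has_derivative_at2)
      moreover have "\<forall>\<^sub>F \<tau> in at 0. norm (?e \<tau>) = norm ((f (x + \<tau> *\<^sub>R v) - f x) /\<^sub>R \<tau> - f' x v)"
        unfolding eventually_at_filter
      proof (rule always_eventually, intro allI impI)
        fix \<tau> :: real assume "\<tau> \<noteq> 0"
        hence "(f (x + \<tau> *\<^sub>R v) - f x) /\<^sub>R \<tau> - f' x v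
            = (1 / \<tau>) *\<^sub>R (f (x + \<tau> *\<^sub>R v) - (f x + \<tau> *\<^sub>R f' x v))"
          by (simp add: algebra_simps divide_inverse)
        thus "norm (?e \<tau>) = norm ((f (x + \<tau> *\<^sub>R v) - f x) /\<^sub>R \<tau> - f' x v)"
          by simp
      qed
      ultimately have "((\<lambda>\<tau>. norm ((f (x + \<tau> *\<^sub>R v) - f x) /\<^sub>R \<tau> - f' x v)) \<longlongrightarrow> 0) (at 0)"
        by (rule Lim_transform_eventually[OF tendsto_norm_zero])
      thus ?thesis by (simp only: tendsto_norm_zero_iff LIM_zero_iff)
    qed
    have "filterlim h (at 0) sequentially"
      unfolding h_def filterlim_at using LIMSEQ_inverse_real_of_nat by auto
    from filterlim_compose[OF * this] show ?thesis by (simp add: s_def)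
  qed
  \<comment> \<open>Steps have length at most 1, so a translate moves a point by at most
    \<open>norm v\<close>; beyond \<open>r + norm v\<close> both values in the quotient are
    0.\<close>
  have dom: "norm (s n x) \<le> indicator (cball 0 (r + norm v)) x * M" for n x
  proof (cases "norm x \<le> r + norm v")
    case True
    have "norm (f (x + h n *\<^sub>R v) - f (x + 0 *\<^sub>R v)) \<le> M * norm (h n - 0)"
    proof (rule differentiable_bound[where S = UNIV and f = "\<lambda>\<tau>. f (x + \<tau> *\<^sub>R v)"])
      fix \<tau> :: real
      show "((\<lambda>\<tau>. f (x + \<tau> *\<^sub>R v)) has_derivative (\<lambda>\<sigma>. f' (x + \<tau> *\<^sub>R v) (\<sigma> *\<^sub>R v))) (at \<tau>)"
        by (rule has_derivative_compose[OF _ deriv]) (auto intro!: derivative_eq_intros)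
      show "onorm (\<lambda>\<sigma>. f' (x + \<tau> *\<^sub>R v) (\<sigma> *\<^sub>R v)) \<le> M"
      proof (rule onorm_le)
        fix \<sigma> :: real
        show "norm (f' (x + \<tau> *\<^sub>R v) (\<sigma> *\<^sub>R v)) \<le> M * norm \<sigma>"
          using mult_right_mono[OF bound[of "x + \<tau> *\<^sub>R v"], of "\<bar>\<sigma>\<bar>"]
          by (simp add: linear_scale[OF has_derivative_linear[OF deriv]] mult.commute)
      qed
    qed auto
    moreover have "norm (s n x) = norm (f (x + h n *\<^sub>R v) - f x) / h n"
      using h[of n] by (simp add: s_def divide_inverse mult.commute)
    ultimately show ?thesis using True h[of n] by (simp add: pos_divide_le_eq)
  next
    case False
    have "h n * norm v \<le> norm v" using h[of n] by (simp add: mult_left_le_one_le)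
    moreover have "norm x - norm (h n *\<^sub>R v) \<le> norm (x + h n *\<^sub>R v)" by (rule norm_diff_ineq)
    ultimately have "norm (x + h n *\<^sub>R v) > r" using False h[of n] by simp
    moreover have "norm x > r" using False norm_ge_zero[of v] by linarith
    ultimately show ?thesis using supp by (simp add: s_def M)
  qed
  have [measurable]: "(\<lambda>x. f' x v) \<in> borel_measurable lborel"
    by (rule borel_measurable_LIMSEQ_metric[OF s_meas lim])
  have w: "integrable lborel (\<lambda>x. indicator (cball 0 (r + norm v)) (x::'a) * M)"
    using emeasure_lborel_cball_finite[of "0::'a" "r + norm v"]
    by (intro integrable_mult_left integrable_real_indicator) auto
  show "integrable lborel (\<lambda>x. f' x v)"
    by (rule integrable_dominated_convergence[where s=s, OF _ s_meas w]) (use lim dom in auto)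
  have "(\<lambda>n. integral\<^sup>L lborel (s n)) \<longlonglongrightarrow> (LINT x|lborel. f' x v)"
    by (rule integral_dominated_convergence[where s=s, OF _ s_meas w]) (use lim dom in auto)
  thus "(LINT x|lborel. f' x v) = 0"
    by (simp add: s_int LIMSEQ_const_iff)
qed

section \<open>The gradient of the phase\<close>

text \<open>\<open>dS\<close> is \<open>\<partial>S/\<partial>\<xi>\<close>, so the real-linear derivative of \<open>S\<close> in direction \<open>v\<close> is \<open>2 Re (dS u \<xi> * v)\<close>.\<close>

definition dS :: "complex \<Rightarrow> complex \<Rightarrow> complex" where
  "dS u \<xi> = 3 * \<xi>^2 - 6 * \<xi> / cnj \<xi> + 3 * cnj \<xi>^2 / \<xi>^2 + cnj u / 2"

text \<open>Radial projection to the sphere of radius \<open>R\<close> does not expand distances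
  outside the ball. With k the cosine of the angle, the difference of the two squares is (|x| -
  |y|)^2 + (|x| |y| - R^2) (2 - 2 k), a sum of nonnegative terms.\<close>

lemma norm_sgn_diff_le:
  fixes x y :: "'a::real_inner"
  assumes "0 < R" "R \<le> norm x" "R \<le> norm y"
  shows "R * norm (sgn x - sgn y) \<le> norm (x - y)"
proof (rule power2_le_imp_le)
  define k where "k = sgn x \<bullet> sgn y"
  have s: "norm (sgn x) = 1" "norm (sgn y) = 1" using assms by (auto simp: norm_sgn)
  have x: "x = norm x *\<^sub>R sgn x" and y: "y = norm y *\<^sub>R sgn y"
    by (cases "x = 0"; cases "y = 0"; simp add: sgn_div_norm)+
  have "k \<le> 1" using norm_cauchy_schwarz[of "sgn x" "sgn y"] s by (simp add: k_def)
  have "(norm (x - y))\<^sup>2 = norm x ^ 2 + norm y ^ 2 - 2 * (x \<bullet> y)"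
    by (simp add: power2_norm_eq_inner inner_diff inner_commute)
  also have "x \<bullet> y = norm x * norm y * k"
    by (subst x, subst y) (simp add: k_def)
  finally have 1: "(norm (x - y))\<^sup>2 = norm x ^ 2 + norm y ^ 2 - 2 * (norm x * norm y * k)" .
  have 2: "(norm (sgn x - sgn y))\<^sup>2 = 2 - 2 * k"
    using dot_norm_neg[of "sgn x" "sgn y"] s by (simp add: k_def)
  have "R * R \<le> norm x * norm y" using assms by (intro mult_mono) auto
  hence "0 \<le> (norm x - norm y)^2 + (norm x * norm y - R * R) * (2 - 2 * k)"
    using \<open>k \<le> 1\<close> by (intro add_nonneg_nonneg mult_nonneg_nonneg) auto
  thus "(R * norm (sgn x - sgn y))\<^sup>2 \<le> (norm (x - y))\<^sup>2"
    unfolding power_mult_distrib 1 2 by (simp add: power2_eq_square algebra_simps)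
qed simp

lemma norm_power_diff_le:
  fixes z w :: complex
  assumes "norm z = 1" "norm w = 1"
  shows "norm (z ^ n - w ^ n) \<le> n * norm (z - w)"
  using norm_power_diff[of z w n] assms by simp

text \<open>The two quotients in \<open>dS\<close> are homogeneous of degree 0. Written in terms of
  \<open>sgn \<xi>\<close> they become powers of a unit vector, whose variation is controlled by the
  change of direction alone.\<close>

lemma dS_sgn:
  assumes "\<xi> \<noteq> 0"
  shows "dS u \<xi> = 3 * \<xi>^2 - 6 * sgn \<xi> ^ 2 + 3 * cnj (sgn \<xi>) ^ 4 + cnj u / 2"
proof -
  have n: "\<xi> * cnj \<xi> = (of_real (norm \<xi>))^2" by (metis complex_norm_square of_real_power)
  have s: "sgn \<xi> = \<xi> / of_real (norm \<xi>)" by (simp add: sgn_eq)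
  have "sgn \<xi> ^ 2 = \<xi>^2 / (\<xi> * cnj \<xi>)" unfolding s n power_divide ..
  also have "\<dots> = \<xi> / cnj \<xi>" using assms by (simp add: power2_eq_square)
  finally have 1: "sgn \<xi> ^ 2 = \<xi> / cnj \<xi>" .
  have "cnj (sgn \<xi>) ^ 4 = cnj \<xi> ^ 4 / (of_real (norm \<xi>)^2)^2"
    by (simp add: s power_divide)
  also have "\<dots> = cnj \<xi>^2 / \<xi>^2"
    using assms unfolding n[symmetric] by (simp add: field_simps power_numeral_reduce)
  finally have 2: "cnj (sgn \<xi>) ^ 4 = cnj \<xi>^2 / \<xi>^2" .
  show ?thesis unfolding dS_def 1 2 by simp
qed

text \<open>The quadratic parts differ by 3 (x - y) (x + y), while the angular parts differ by at
  most (12 + 12) |sgn x - sgn y|, hence by at most 24 |x - y| / R. The parameter \<open>u\<close>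
  cancels, which is the source of uniformity.\<close>

lemma dS_diff_ge:
  assumes "0 < R" "R \<le> norm x" "R \<le> norm y"
  shows "3 * norm (x - y) * (norm (x + y) - 8 / R) \<le> norm (dS u x - dS u y)"
proof -
  let ?s = "sgn x" and ?r = "sgn y"
  have nz: "x \<noteq> 0" "y \<noteq> 0" using assms by auto
  have s: "norm ?s = 1" "norm ?r = 1" using nz by (auto simp: norm_sgn)
  have d: "norm (?s - ?r) \<le> norm (x - y) / R"
    using norm_sgn_diff_le[OF assms] assms by (simp add: field_simps)
  have "dS u x - dS u y = 3 * ((x - y) * (x + y)) - (6 * (?s^2 - ?r^2) - 3 * (cnj ?s ^ 4 - cnj ?r ^ 4))"
    unfolding dS_sgn[OF nz(1)] dS_sgn[OF nz(2)] by (simp add: algebra_simps power2_eq_square)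
  moreover have "norm (6 * (?s^2 - ?r^2) - 3 * (cnj ?s ^ 4 - cnj ?r ^ 4))
      \<le> norm (6 * (?s^2 - ?r^2)) + norm (3 * (cnj ?s ^ 4 - cnj ?r ^ 4))"
    by (rule norm_triangle_ineq4)
  moreover have "norm (6 * (?s^2 - ?r^2)) \<le> 12 * norm (?s - ?r)"
    using norm_power_diff_le[OF s, of 2] unfolding norm_mult by simp
  moreover have "norm (3 * (cnj ?s ^ 4 - cnj ?r ^ 4)) \<le> 12 * norm (?s - ?r)"
    using norm_power_diff_le[of "cnj ?s" "cnj ?r" 4] s
    unfolding norm_mult by (simp flip: complex_cnj_diff)
  moreover have "norm (3 * ((x - y) * (x + y))) = 3 * norm (x - y) * norm (x + y)"
    by (simp add: norm_mult)
  ultimately have "3 * norm (x - y) * norm (x + y) - 24 * (norm (x - y) / R) \<le> norm (dS u x - dS u y)"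
    using d norm_triangle_ineq2[of "3 * ((x - y) * (x + y))" "6 * (?s^2 - ?r^2) - 3 * (cnj ?s ^ 4 - cnj ?r ^ 4)"]
    by simp
  thus ?thesis by (simp add: algebra_simps)
qed

text \<open>If \<open>z\<close> minimised |f| over \<open>A\<close>, then |f x - f z| would be at
  most 2 |f x|, and expansion would give the claim. A minimiser need not exist in \<open>A\<close>,
  so \<open>z\<close> is taken as a subsequential limit of a minimising sequence; expansion against
  one fixed point keeps that sequence bounded.\<close>

lemma quasi_minimiser:
  fixes f :: "'a::euclidean_space \<Rightarrow> 'b::real_normed_vector"
  assumes "0 < c" "0 < R" "\<And>x. x \<in> A \<Longrightarrow> R \<le> norm x"
    and expand: "\<And>x y. x \<in> A \<Longrightarrow> y \<in> A \<Longrightarrow> c * norm x * norm (x - y) \<le> norm (f x - f y)"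
  shows "\<exists>z. \<forall>x\<in>A. c * norm x * norm (x - z) \<le> 2 * norm (f x)"
proof (cases "A = {}")
  case False
  then obtain x0 where x0: "x0 \<in> A" by blast
  define d where "d = (INF x\<in>A. norm (f x))"
  have d: "d \<le> norm (f x)" if "x \<in> A" for x
    unfolding d_def using that by (intro cINF_lower bdd_belowI[where m = 0]) auto
  have "\<exists>y\<in>A. norm (f y) < d + inverse (real (Suc n))" for n
    using cInf_lessD[of "(\<lambda>x. norm (f x)) ` A" "d + inverse (real (Suc n))"] False
    by (auto simp: d_def)
  then obtain y where y: "\<And>n. y n \<in> A" "\<And>n. norm (f (y n)) < d + inverse (real (Suc n))"
    by metis
  have "norm (y n) \<le> norm x0 + (norm (f x0) + (d + 1)) / (c * R)" for n
  proof -
    have "c * R * norm (x0 - y n) \<le> c * norm x0 * norm (x0 - y n)"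
      using assms(1,3) x0 by (intro mult_right_mono mult_left_mono) auto
    also have "\<dots> \<le> norm (f x0 - f (y n))" by (rule expand[OF x0 y(1)])
    also have "\<dots> \<le> norm (f x0) + norm (f (y n))" by (rule norm_triangle_ineq4)
    also have "\<dots> \<le> norm (f x0) + (d + 1)"
      using y(2)[of n] inverse_le_1_iff[of "real (Suc n)"] by simp
    finally have "norm (x0 - y n) \<le> (norm (f x0) + (d + 1)) / (c * R)"
      using assms by (simp add: field_simps)
    moreover have "norm (y n) \<le> norm x0 + norm (x0 - y n)"
      by norm
    ultimately show ?thesis by linarith
  qed
  hence "bounded (range y)" by (auto simp: bounded_iff)
  then obtain z r where r: "strict_mono r" "(y \<circ> r) \<longlonglongrightarrow> z"
    using bounded_imp_convergent_subsequence by blast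
  have "c * norm x * norm (x - z) \<le> 2 * norm (f x)" if "x \<in> A" for x
  proof (rule LIMSEQ_le)
    show "(\<lambda>n. c * norm x * norm (x - (y \<circ> r) n)) \<longlonglongrightarrow> c * norm x * norm (x - z)"
      by (intro tendsto_intros r)
    show "(\<lambda>n. 2 * norm (f x) + inverse (real (Suc (r n)))) \<longlonglongrightarrow> 2 * norm (f x)"
      using tendsto_add[OF tendsto_const LIMSEQ_subseq_LIMSEQ[OF LIMSEQ_inverse_real_of_nat r(1)], of "2 * norm (f x)"]
      by (simp add: o_def)
    have "c * norm x * norm (x - (y \<circ> r) n) \<le> 2 * norm (f x) + inverse (real (Suc (r n)))" for n
      using expand[OF that y(1)[of "r n"]] norm_triangle_ineq4[of "f x" "f (y (r n))"]
        d[OF that] y(2)[of "r n"] by simp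
    thus "\<exists>N. \<forall>n\<ge>N. c * norm x * norm (x - (y \<circ> r) n) \<le> 2 * norm (f x) + inverse (real (Suc (r n)))"
      by blast
  qed
  thus ?thesis by blast
qed auto

text \<open>Both vectors point nearly along \<open>z\<close>, so their sum is (|x| + |y|) z up to
  errors \<open>\<rho>\<close> |x| and \<open>\<rho>\<close> |y|: there is no cancellation within a
  narrow sector.\<close>

lemma sector_norm_add_ge:
  fixes x y z :: "'a::real_normed_vector"
  assumes "norm z = 1" "norm (sgn x - z) \<le> \<rho>" "norm (sgn y - z) \<le> \<rho>"
  shows "(1 - \<rho>) * (norm x + norm y) \<le> norm (x + y)"
proof -
  have *: "x = norm x *\<^sub>R sgn x" "y = norm y *\<^sub>R sgn y" by (cases "x = 0"; cases "y = 0"; simp add: sgn_div_norm)+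
  have "(norm x + norm y) *\<^sub>R z = (x + y) - (norm x *\<^sub>R (sgn x - z) + norm y *\<^sub>R (sgn y - z))"
    using * by (simp add: algebra_simps)
  moreover have "norm ((norm x + norm y) *\<^sub>R z) = norm x + norm y"
    using assms(1) by simp
  ultimately have "norm x + norm y \<le> norm (x + y) + norm (norm x *\<^sub>R (sgn x - z) + norm y *\<^sub>R (sgn y - z))"
    using norm_triangle_ineq4[of "x + y" "norm x *\<^sub>R (sgn x - z) + norm y *\<^sub>R (sgn y - z)"]
    by simp
  also have "norm (norm x *\<^sub>R (sgn x - z) + norm y *\<^sub>R (sgn y - z)) \<le> norm x * \<rho> + norm y * \<rho>"
    using assms by (intro norm_triangle_le add_mono) (auto intro: mult_left_mono)
  finally show ?thesis by (simp add: algebra_simps)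
qed

text \<open>The circle of directions is covered by finitely many small balls. On each resulting
  sector \<open>dS u\<close> is expanding, so a quasi-minimiser supplies one point per sector. The
  cover, and with it \<open>c\<close> and \<open>N\<close>, depends on \<open>R\<close> only; just
  the points in \<open>Z\<close> move with \<open>u\<close>.\<close>

lemma dS_lower_bound:
  assumes "2 < R"
  shows "\<exists>c>0. \<exists>N. \<forall>u. \<exists>Z. finite Z \<and> card Z \<le> N \<and>
           (\<forall>x. R \<le> norm x \<longrightarrow> (\<exists>z\<in>Z. c * norm x * norm (x - z) \<le> norm (dS u x)))"
proof -
  have R: "4 / R^2 < 1" using assms power_strict_mono[of 2 R 2] by simp
  \<comment> \<open>This solves 1 - \<open>\<rho>\<close> - 4 / R^2 = \<open>\<rho>\<close>, and R >
    2 makes it positive. Since |x| + |y| is at least 2 R, the loss 8 / R is at most (4 / R^2) (|x| +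
    |y|), which leaves \<open>\<rho>\<close> (|x| + |y|).\<close>
  define \<rho> where "\<rho> = (1 - 4 / R^2) / 2"
  have \<rho>: "0 < \<rho>" "4 / R^2 + \<rho> = 1 - \<rho>" using R by (auto simp: \<rho>_def field_simps)
  have "\<exists>K. finite K \<and> K \<subseteq> sphere 0 1 \<and> sphere (0::complex) 1 \<subseteq> (\<Union>w\<in>K. ball w \<rho>)"
    using seq_compact_imp_totally_bounded[OF compact_imp_seq_compact[OF compact_sphere[of "0::complex" 1]]] \<rho>(1) by blast
  then obtain K where K: "finite K" "K \<subseteq> sphere 0 1" "sphere (0::complex) 1 \<subseteq> (\<Union>w\<in>K. ball w \<rho>)"
    by blast
  define A where "A w = {x. R \<le> norm x \<and> norm (sgn x - w) \<le> \<rho>}" for w :: complex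
  have expand: "3 * \<rho> * norm x * norm (x - y) \<le> norm (dS u x - dS u y)"
    if "w \<in> K" "x \<in> A w" "y \<in> A w" for w x y u
  proof -
    have xy: "R \<le> norm x" "R \<le> norm y" using that by (auto simp: A_def)
    have "(1 - \<rho>) * (norm x + norm y) \<le> norm (x + y)"
      using that K by (intro sector_norm_add_ge[of w]) (auto simp: A_def)
    moreover have "8 / R \<le> 4 / R^2 * (norm x + norm y)"
      using xy assms by (simp add: field_simps power2_eq_square)
    ultimately have "\<rho> * (norm x + norm y) \<le> norm (x + y) - 8 / R"
      unfolding \<rho>(2)[symmetric] by (simp add: algebra_simps)
    moreover have "\<rho> * norm x \<le> \<rho> * (norm x + norm y)" using \<rho> by simp
    ultimately have "\<rho> * norm x \<le> norm (x + y) - 8 / R" by linarith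
    hence "3 * norm (x - y) * (\<rho> * norm x) \<le> 3 * norm (x - y) * (norm (x + y) - 8 / R)"
      by (intro mult_left_mono) auto
    also have "\<dots> \<le> norm (dS u x - dS u y)"
      using assms xy by (intro dS_diff_ge) auto
    finally show ?thesis by (simp add: mult_ac)
  qed
  have "\<forall>u w. \<exists>z. w \<in> K \<longrightarrow> (\<forall>x\<in>A w. 3 * \<rho> * norm x * norm (x - z) \<le> 2 * norm (dS u x))"
  proof (intro allI)
    fix u w
    show "\<exists>z. w \<in> K \<longrightarrow> (\<forall>x\<in>A w. 3 * \<rho> * norm x * norm (x - z) \<le> 2 * norm (dS u x))"
    proof (cases "w \<in> K")
      case True
      have "\<exists>z. \<forall>x\<in>A w. 3 * \<rho> * norm x * norm (x - z) \<le> 2 * norm (dS u x)"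
        using assms \<rho> expand[OF True] by (intro quasi_minimiser[of _ R]) (auto simp: A_def)
      thus ?thesis by blast
    qed auto
  qed
  then obtain z where z: "\<And>u w x. w \<in> K \<Longrightarrow> x \<in> A w \<Longrightarrow> 3 * \<rho> * norm x * norm (x - z u w) \<le> 2 * norm (dS u x)"
    unfolding choice_iff by blast
  have "finite (z u ` K) \<and> card (z u ` K) \<le> card K \<and> (\<forall>x. R \<le> norm x \<longrightarrow>
      (\<exists>z\<in>z u ` K. 3 * \<rho> / 2 * norm x * norm (x - z) \<le> norm (dS u x)))" for u
  proof (intro conjI allI impI finite_imageI card_image_le K)
    fix x :: complex assume x: "R \<le> norm x"
    hence "sgn x \<in> sphere 0 1" using assms by (auto simp: norm_sgn)
    then obtain w where w: "w \<in> K" "dist w (sgn x) < \<rho>" using K by (auto simp: subset_iff)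
    hence "x \<in> A w" using x by (auto simp: A_def dist_norm norm_minus_commute)
    from z[OF w(1) this, of u] w show "\<exists>z\<in>z u ` K. 3 * \<rho> / 2 * norm x * norm (x - z) \<le> norm (dS u x)"
      by (auto intro!: bexI[of _ w])
  qed
  hence "\<forall>u. \<exists>Z. finite Z \<and> card Z \<le> card K \<and> (\<forall>x. R \<le> norm x \<longrightarrow>
      (\<exists>z\<in>Z. 3 * \<rho> / 2 * norm x * norm (x - z) \<le> norm (dS u x)))" by blast
  moreover have "0 < 3 * \<rho> / 2" using \<rho> by simp
  ultimately show ?thesis by blast
qed

section \<open>Uniform bound for the majorant\<close>

text \<open>A profile independent of \<open>t\<close> and \<open>u\<close>, integrable in the plane
  for q < 2 < s, whose translates dominate the majorant. On the unit circle both pieces count, which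
  is harmless for an upper bound.\<close>

definition envelope :: "real \<Rightarrow> real \<Rightarrow> complex \<Rightarrow> real" where
  "envelope q s x = indicator {x. norm x \<le> 1} x * norm x powr (-q)
                  + indicator {x. norm x \<ge> 1} x * norm x powr (-s)"

lemma envelope_nonneg: "0 \<le> envelope q s x"
  by (simp add: envelope_def)

lemma integrable_envelope:
  assumes "0 \<le> q" "q < 2" "2 < s"
  shows "integrable lborel (envelope q s)"
proof -
  have "integrable lborel (\<lambda>x::complex. indicator {x. norm x \<le> 1} x * norm x powr (-q))"
    using nn_integral_powr_norm_at_zero[where 'a = complex, of q] assms
    by (intro integrableI_nonneg) auto
  moreover have "integrable lborel (\<lambda>x::complex. indicator {x. norm x \<ge> 1} x * norm x powr (-s))"
    using nn_integral_powr_norm_at_infinity[where 'a = complex, of s] assms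
    by (intro integrableI_nonneg) auto
  ultimately show ?thesis unfolding envelope_def by (rule Bochner_Integration.integrable_add)
qed

text \<open>Up to a constant this bounds what integration by parts leaves behind. The first term of
  the numerator comes from differentiating the amplitude, the second from differentiating the vector
  field, as the derivative of \<open>dS\<close> grows like |x|.\<close>

definition majorant :: "real \<Rightarrow> real \<Rightarrow> real \<Rightarrow> complex \<Rightarrow> complex \<Rightarrow> real" where
  "majorant R \<alpha> t u x = indicator {x. R \<le> norm x} x *
     ((norm x powr (\<alpha> - 1) * norm (dS u x) + norm x powr (\<alpha> + 1)) / (1 / t + norm (dS u x) ^ 2))"

text \<open>The left side is the weighted geometric mean of 1/t and P^2 with weights
  \<open>\<epsilon>\<close> and 1 - \<open>\<epsilon>\<close>, and both are at most their
  sum.\<close>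

lemma powr_interpolation_le:
  fixes t P \<epsilon> :: real
  assumes "0 < t" "0 < P" "0 \<le> \<epsilon>" "\<epsilon> \<le> 1"
  shows "t powr (-\<epsilon>) * P powr (2 - 2 * \<epsilon>) \<le> 1 / t + P^2"
proof -
  let ?Q = "1 / t + P^2"
  have Q: "0 < ?Q" using assms by (simp add: add_pos_pos)
  have "(1 / t) powr \<epsilon> * (P^2) powr (1 - \<epsilon>) \<le> ?Q powr \<epsilon> * ?Q powr (1 - \<epsilon>)"
    using assms by (intro mult_mono powr_mono2) auto
  also have "\<dots> = ?Q" using Q by (simp add: powr_add[symmetric])
  also have "(1 / t) powr \<epsilon> = t powr (-\<epsilon>)"
    using assms by (simp add: powr_divide powr_minus_divide)
  also have "(P^2) powr (1 - \<epsilon>) = P powr (2 - 2 * \<epsilon>)"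
    using assms by (simp add: powr_numeral[symmetric] powr_powr algebra_simps del: powr_numeral)
  finally show ?thesis .
qed

text \<open>Interpolation treats the term with l^(\<alpha>+1) directly. The other term is no larger
  when P \<le> l^2; when P > l^2, interpolation leaves P^(2\<epsilon>-1), a negative power, which is
  at most l^(4\<epsilon>-2). Thus \<open>P\<close> survives only with a negative exponent, ready for
  a lower bound on |dS|.\<close>

lemma majorant_quotient_le:
  fixes t P l \<epsilon> \<alpha> :: real
  assumes "0 < t" "0 < P" "1 \<le> l" "0 < \<epsilon>" "\<epsilon> < 1 / 4"
  shows "(l powr (\<alpha> - 1) * P + l powr (\<alpha> + 1)) / (1 / t + P^2)
    \<le> t powr \<epsilon> * (l powr (\<alpha> - 3 + 4 * \<epsilon>) + 2 * (l powr (\<alpha> + 1) * P powr (- (2 - 2 * \<epsilon>))))"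
proof -
  let ?Q = "1 / t + P^2"
  have Q: "0 < ?Q" using assms by (simp add: add_pos_pos)
  have Qi: "1 / ?Q \<le> t powr \<epsilon> * P powr (- (2 - 2 * \<epsilon>))"
  proof -
    have "1 / ?Q \<le> 1 / (t powr (-\<epsilon>) * P powr (2 - 2 * \<epsilon>))"
      using assms Q by (intro divide_left_mono powr_interpolation_le) auto
    also have "\<dots> = t powr \<epsilon> * P powr (- (2 - 2 * \<epsilon>))"
      unfolding powr_minus[of t] powr_minus[of P "2 - 2 * \<epsilon>"] by (simp add: divide_inverse)
    finally show ?thesis .
  qed
  have 1: "l powr (\<alpha> + 1) / ?Q \<le> t powr \<epsilon> * (l powr (\<alpha> + 1) * P powr (- (2 - 2 * \<epsilon>)))"
    using mult_left_mono[OF Qi, of "l powr (\<alpha> + 1)"] by (simp add: mult_ac)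
  have 2: "l powr (\<alpha> - 1) * P / ?Q
      \<le> t powr \<epsilon> * (l powr (\<alpha> - 3 + 4 * \<epsilon>) + l powr (\<alpha> + 1) * P powr (- (2 - 2 * \<epsilon>)))"
  proof (cases "P \<le> l^2")
    case True
    have "l powr (\<alpha> - 1) * P \<le> l powr (\<alpha> - 1) * l powr 2"
      using True assms by (intro mult_left_mono) auto
    also have "\<dots> = l powr (\<alpha> + 1)" by (simp only: powr_add[symmetric]) (simp add: add.commute)
    finally have "l powr (\<alpha> - 1) * P / ?Q \<le> l powr (\<alpha> + 1) / ?Q"
      using Q by (intro divide_right_mono) auto
    also note 1
    also have "t powr \<epsilon> * (l powr (\<alpha> + 1) * P powr (- (2 - 2 * \<epsilon>))) \<le>
      t powr \<epsilon> * (l powr (\<alpha> - 3 + 4 * \<epsilon>) + l powr (\<alpha> + 1) * P powr (- (2 - 2 * \<epsilon>)))"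
      by (intro mult_left_mono) auto
    finally show ?thesis .
  next
    case False
    have "P powr 1 * P powr (- (2 - 2 * \<epsilon>)) = P powr (2 * \<epsilon> - 1)"
      by (simp only: powr_add[symmetric]) simp
    also have "\<dots> \<le> (l powr 2) powr (2 * \<epsilon> - 1)"
      using False assms by (intro powr_mono2') auto
    also have "\<dots> = l powr (4 * \<epsilon> - 2)" by (simp add: powr_powr algebra_simps)
    finally have *: "P powr 1 * P powr (- (2 - 2 * \<epsilon>)) \<le> l powr (4 * \<epsilon> - 2)" .
    have "P / ?Q = P * (1 / ?Q)" by simp
    also have "\<dots> \<le> P * (t powr \<epsilon> * P powr (- (2 - 2 * \<epsilon>)))"
      using assms by (intro mult_left_mono Qi) auto
    also have "\<dots> = t powr \<epsilon> * (P powr 1 * P powr (- (2 - 2 * \<epsilon>)))"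
      using assms by (simp only: powr_one mult_ac)
    also have "\<dots> \<le> t powr \<epsilon> * l powr (4 * \<epsilon> - 2)"
      by (intro mult_left_mono *) auto
    finally have "P / ?Q \<le> t powr \<epsilon> * l powr (4 * \<epsilon> - 2)" .
    hence "l powr (\<alpha> - 1) * (P / ?Q) \<le> l powr (\<alpha> - 1) * (t powr \<epsilon> * l powr (4 * \<epsilon> - 2))"
      by (rule mult_left_mono) auto
    also have "\<dots> = t powr \<epsilon> * (l powr (\<alpha> - 1) * l powr (4 * \<epsilon> - 2))" by simp
    also have "l powr (\<alpha> - 1) * l powr (4 * \<epsilon> - 2) = l powr (\<alpha> - 3 + 4 * \<epsilon>)"
      unfolding powr_add[symmetric] by (rule arg_cong[of _ _ "(powr) l"]) simp
    also have "t powr \<epsilon> * \<dots> \<le> t powr \<epsilon> * (l powr (\<alpha> - 3 + 4 * \<epsilon>) + l powr (\<alpha> + 1) * P powr (- (2 - 2 * \<epsilon>)))"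
      by (intro mult_left_mono) auto
    finally show ?thesis by simp
  qed
  show ?thesis using 1 2 unfolding add_divide_distrib distrib_left by linarith
qed

text \<open>For small \<open>y\<close> the factor in \<open>x\<close> is at most 1; otherwise the
  smaller of the two norms can carry the whole exponent. Taking y = x - z gives a bound whose
  integral does not depend on \<open>z\<close>.\<close>

lemma powr_mult_powr_le_envelope:
  fixes x y :: complex
  assumes "1 \<le> norm x" "y \<noteq> 0" "0 \<le> a" "0 \<le> q"
  shows "norm x powr (-a) * norm y powr (-q) \<le> envelope q (a + q) x + envelope q (a + q) y"
proof -
  consider "norm y \<le> 1" | "1 \<le> norm y" "norm y \<le> norm x" | "1 \<le> norm y" "norm x \<le> norm y"
    by linarith
  thus ?thesis
  proof cases
    case 1
    have "norm x powr (-a) \<le> norm x powr 0"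
      using assms by (intro powr_mono) auto
    also have "norm x powr 0 = 1" using assms by auto
    finally have "norm x powr (-a) * norm y powr (-q) \<le> 1 * norm y powr (-q)"
      by (rule mult_right_mono) simp
    also have "\<dots> \<le> envelope q (a + q) y"
      using 1 by (simp add: envelope_def)
    finally show ?thesis using envelope_nonneg[of q "a + q" x] by linarith
  next
    case 2
    have "norm x powr (-a) * norm y powr (-q) \<le> norm y powr (-a) * norm y powr (-q)"
      using 2 assms by (intro mult_right_mono powr_mono2') auto
    also have "\<dots> = norm y powr (-(a + q))" by (simp add: powr_add[symmetric])
    also have "\<dots> \<le> envelope q (a + q) y"
      using 2 by (simp add: envelope_def)
    finally show ?thesis using envelope_nonneg[of q "a + q" x] by linarith
  next
    case 3
    have "norm x powr (-a) * norm y powr (-q) \<le> norm x powr (-a) * norm x powr (-q)"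
      using 3 assms by (intro mult_left_mono powr_mono2') auto
    also have "\<dots> = norm x powr (-(a + q))" by (simp add: powr_add[symmetric])
    also have "\<dots> \<le> envelope q (a + q) x"
      using assms by (simp add: envelope_def)
    finally show ?thesis using envelope_nonneg[of q "a + q" y] by linarith
  qed
qed

lemma borel_measurable_dS [measurable]: "dS u \<in> borel_measurable borel"
proof -
  have [measurable]: "cnj \<in> borel_measurable borel"
    by (intro borel_measurable_continuous_onI continuous_intros)
  show ?thesis unfolding dS_def[abs_def] by measurable
qed

text \<open>The majorant is dominated by the envelope plus its translates by the points of
  \<open>Z u\<close>. Translation invariance removes the positions of these points, and their number
  is at most \<open>N\<close>, so no trace of \<open>u\<close> remains in the bound.\<close>

lemma majorant_integral_le:
  assumes "2 < R" "0 \<le> \<alpha>" "\<alpha> < 1" "0 < \<epsilon>" "\<epsilon> < (1 - \<alpha>) / 4"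
  shows "\<exists>C\<ge>0. \<forall>t>0. \<forall>u. integrable lborel (majorant R \<alpha> t u) \<and>
           integral\<^sup>L lborel (majorant R \<alpha> t u) \<le> C * t powr \<epsilon>"
proof -
  \<comment> \<open>Here \<open>q\<close> is the power of 1/P left by interpolation and a = q -
    (\<alpha> + 1) is the decay in |x| left after using P \<ge> c |x| |x - z|. The condition
    \<epsilon> < (1 - \<alpha>)/4 says precisely that s > 2, and -s is also the exponent of the
    remaining term.\<close>
  define q a s where "q = 2 - 2 * \<epsilon>" and "a = 1 - \<alpha> - 2 * \<epsilon>" and "s = a + q"
  have s: "s = 3 - \<alpha> - 4 * \<epsilon>" by (simp add: s_def a_def q_def)
  have qs: "0 \<le> q" "q < 2" "2 < s" "0 \<le> a" using assms by (auto simp: q_def s a_def)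
  have e4: "\<epsilon> < 1 / 4" using assms by simp
  let ?k = "envelope q s"
  have k_int: "integrable lborel ?k" using qs by (intro integrable_envelope)
  define K where "K = integral\<^sup>L lborel ?k"
  have K: "0 \<le> K" unfolding K_def by (simp add: envelope_nonneg)
  obtain c N where c: "0 < c" and "\<forall>u. \<exists>Z. finite Z \<and> card Z \<le> N \<and>
      (\<forall>x. R \<le> norm x \<longrightarrow> (\<exists>z\<in>Z. c * norm x * norm (x - z) \<le> norm (dS u x)))"
    using dS_lower_bound[OF assms(1)] by blast
  then obtain Z where Z: "\<And>u. finite (Z u)" "\<And>u. card (Z u) \<le> N"
      "\<And>u x. R \<le> norm x \<Longrightarrow> \<exists>z\<in>Z u. c * norm x * norm (x - z) \<le> norm (dS u x)"
    unfolding choice_iff by blast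
  define M where "M = 1 + 2 * c powr (-q)"
  have M: "0 \<le> M" by (simp add: M_def)
  define g where "g u x = ?k x + (\<Sum>z\<in>Z u. ?k (-z + x))" for u x
  have sum_int: "integrable lborel (\<lambda>x. \<Sum>z\<in>Z u. ?k (-z + x))" for u
    by (rule Bochner_Integration.integrable_sum) (rule integrable_translate[OF k_int])
  have g_int: "integrable lborel (g u)" for u
    unfolding g_def by (rule Bochner_Integration.integrable_add[OF k_int sum_int])
  have g_le: "integral\<^sup>L lborel (g u) \<le> (1 + N) * K" for u
  proof -
    have "(LINT x|lborel. (\<Sum>z\<in>Z u. ?k (-z + x))) = (\<Sum>z\<in>Z u. (LINT x|lborel. ?k (-z + x)))"
      by (rule Bochner_Integration.integral_sum) (rule integrable_translate[OF k_int])
    also have "\<dots> = card (Z u) * K"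
      unfolding integral_translate[OF k_int] K_def by simp
    finally have "integral\<^sup>L lborel (g u) = K + card (Z u) * K"
      unfolding g_def K_def using Bochner_Integration.integral_add[OF k_int sum_int] by simp
    also have "\<dots> \<le> K + N * K" using K Z(2)[of u] by (intro add_left_mono mult_right_mono) auto
    finally show ?thesis by (simp add: algebra_simps)
  qed
  \<comment> \<open>At a point of \<open>Z u\<close> the lower bound on |dS| may degenerate to 0;
    these finitely many points form a null set.\<close>
  have bound: "majorant R \<alpha> t u x \<le> t powr \<epsilon> * M * g u x" if t: "0 < t" and x: "x \<notin> Z u" for t u x
  proof (cases "R \<le> norm x")
    case True
    obtain z where z: "z \<in> Z u" "c * norm x * norm (x - z) \<le> norm (dS u x)"
      using Z(3)[OF True] by blast
    have nz: "x - z \<noteq> 0" "0 < norm x" using x z True assms by auto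
    let ?P = "norm (dS u x)"
    have l1: "1 \<le> norm x" using True assms by linarith
    have pos: "0 < c * norm x * norm (x - z)" using c nz by simp
    hence P: "0 < ?P" using z by linarith
    have "norm x powr (\<alpha> + 1) * ?P powr (-q) \<le> norm x powr (\<alpha> + 1) * (c * norm x * norm (x - z)) powr (-q)"
      using pos z qs by (intro mult_left_mono powr_mono2') auto
    also have "\<dots> = c powr (-q) * ((norm x powr (\<alpha> + 1) * norm x powr (-q)) * norm (x - z) powr (-q))"
      using c by (simp add: powr_mult mult_ac)
    also have "norm x powr (\<alpha> + 1) * norm x powr (-q) = norm x powr (-a)"
      by (simp only: powr_add[symmetric]) (simp add: q_def a_def algebra_simps)
    also have "c powr (-q) * (norm x powr (-a) * norm (x - z) powr (-q)) \<le> c powr (-q) * (?k x + ?k (x - z))"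
      using l1 nz qs unfolding s_def by (intro mult_left_mono powr_mult_powr_le_envelope) auto
    finally have 1: "norm x powr (\<alpha> + 1) * ?P powr (-q) \<le> c powr (-q) * (?k x + ?k (x - z))" .
    have 2: "norm x powr (\<alpha> - 3 + 4 * \<epsilon>) \<le> ?k x"
      using l1 by (simp add: envelope_def s algebra_simps)
    have 3: "?k (x - z) \<le> (\<Sum>z\<in>Z u. ?k (-z + x))"
      using member_le_sum[of z "Z u" "\<lambda>z. ?k (-z + x)"] z Z(1) envelope_nonneg by simp
    have "majorant R \<alpha> t u x \<le> t powr \<epsilon> * (norm x powr (\<alpha> - 3 + 4 * \<epsilon>) + 2 * (norm x powr (\<alpha> + 1) * ?P powr (- q)))"
      using majorant_quotient_le[OF t P l1 assms(4) e4, of \<alpha>] True by (simp add: majorant_def q_def)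
    also have "\<dots> \<le> t powr \<epsilon> * (g u x + 2 * (c powr (-q) * g u x))"
    proof (intro mult_left_mono add_mono order_trans[OF 2] order_trans[OF 1])
      show "?k x \<le> g u x" using 3 envelope_nonneg[of q s "x - z"] by (simp add: g_def)
      show "?k x + ?k (x - z) \<le> g u x" using 3 by (simp add: g_def)
    qed auto
    finally show ?thesis by (simp add: M_def algebra_simps)
  next
    case False
    have "0 \<le> g u x" by (auto simp: g_def intro!: add_nonneg_nonneg sum_nonneg envelope_nonneg)
    thus ?thesis using False M by (simp add: majorant_def)
  qed
  have ae: "AE x in lborel. x \<notin> Z u" for u
    using AE_not_in[OF finite_imp_null_set_lborel[OF Z(1)[of u]]] .
  have pos: "0 \<le> majorant R \<alpha> t u x" if "0 < t" for t u x
    using that by (simp add: majorant_def)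
  show ?thesis
  proof (intro exI[of _ "M * ((1 + N) * K)"] conjI allI impI)
    show "0 \<le> M * ((1 + N) * K)" using M K by simp
    fix t :: real and u :: complex assume t: "0 < t"
    have g': "integrable lborel (\<lambda>x. t powr \<epsilon> * M * g u x)"
      by (intro integrable_mult_right g_int)
    show int: "integrable lborel (majorant R \<alpha> t u)"
    proof (rule Bochner_Integration.integrable_bound[OF g'])
      show "majorant R \<alpha> t u \<in> borel_measurable lborel"
        unfolding majorant_def[abs_def] by measurable
      show "AE x in lborel. norm (majorant R \<alpha> t u x) \<le> norm (t powr \<epsilon> * M * g u x)"
        using ae[of u]
      proof eventually_elim
        case (elim x)
        thus ?case using bound[OF t elim] pos[OF t, of u x] by simp
      qed
    qed
    have "integral\<^sup>L lborel (majorant R \<alpha> t u) \<le> (LINT x|lborel. t powr \<epsilon> * M * g u x)"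
      using ae[of u] bound[OF t] by (intro integral_mono_AE int g') auto
    also have "\<dots> = t powr \<epsilon> * M * integral\<^sup>L lborel (g u)" by simp
    also have "\<dots> \<le> t powr \<epsilon> * M * ((1 + N) * K)"
      using M by (intro mult_left_mono g_le) auto
    finally show "integral\<^sup>L lborel (majorant R \<alpha> t u) \<le> M * ((1 + N) * K) * t powr \<epsilon>"
      by (simp add: mult_ac)
  qed
qed

section \<open>Integration by parts\<close>

text \<open>The real-linear derivative of \<open>dS u\<close> in direction \<open>v\<close>, hence
  the terms in \<open>cnj v\<close>. It does not involve \<open>u\<close>, which enters
  \<open>dS\<close> only as an additive constant.\<close>

definition dS' :: "complex \<Rightarrow> complex \<Rightarrow> complex" where
  "dS' \<xi> v = 6 * \<xi> * v - 6 * v / cnj \<xi> + 6 * \<xi> * cnj v / cnj \<xi>^2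
     + 6 * cnj \<xi> * cnj v / \<xi>^2 - 6 * cnj \<xi>^2 * v / \<xi>^3"

lemma has_derivative_dS:
  assumes "\<xi> \<noteq> 0"
  shows "(dS u has_derivative dS' \<xi>) (at \<xi>)"
  unfolding dS_def[abs_def] using assms
  by (auto intro!: derivative_eq_intros has_derivative_cnj simp: fun_eq_iff dS'_def)
    (simp add: field_simps power2_eq_square power3_eq_cube power4_eq_xxxx)

text \<open>The leading term contributes 6 |\<xi>| |v|, and each of the four others is 6 |v| /
  |\<xi>|, whence 6 + 24 for |\<xi>| \<ge> 1.\<close>

lemma norm_dS'_le:
  assumes "1 \<le> norm \<xi>"
  shows "norm (dS' \<xi> v) \<le> 30 * norm \<xi> * norm v"
proof -
  let ?n = "norm \<xi>"
  have nz: "\<xi> \<noteq> 0" using assms by auto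
  have "norm (dS' \<xi> v) \<le> norm (6 * \<xi> * v) + norm (6 * v / cnj \<xi>) + norm (6 * \<xi> * cnj v / cnj \<xi>^2)
     + norm (6 * cnj \<xi> * cnj v / \<xi>^2) + norm (6 * cnj \<xi>^2 * v / \<xi>^3)"
    unfolding dS'_def by (intro norm_triangle_le_diff norm_triangle_le add_right_mono order_refl)
  also have "\<dots> = 6 * ?n * norm v + 24 * (norm v / ?n)"
    using nz by (simp add: norm_mult norm_divide norm_power field_simps power2_eq_square power3_eq_cube)
  also have "norm v / ?n \<le> ?n * norm v"
  proof -
    have "1 \<le> ?n * ?n" using assms mult_mono[of 1 ?n 1 ?n] by simp
    hence "norm v \<le> ?n * norm v * ?n"
      using mult_right_mono[of 1 "?n * ?n" "norm v"] by (simp add: mult_ac)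
    thus ?thesis using nz by (simp add: pos_divide_le_eq)
  qed
  finally show ?thesis by simp
qed

lemma has_derivative_S_tilde:
  assumes "\<xi> \<noteq> 0"
  shows "(S_tilde u has_derivative (\<lambda>v. of_real (2 * Re (dS u \<xi> * v)))) (at \<xi>)"
proof -
  have *: "of_real (2 * Re z) = z + cnj z" for z by (simp add: complex_add_cnj)
  show ?thesis
    unfolding S_tilde_def[abs_def] * using assms
    by (auto intro!: derivative_eq_intros has_derivative_cnj simp: fun_eq_iff dS_def)
      (simp add: field_simps power2_eq_square power3_eq_cube)
qed

section \<open>The oscillating factor and the regularised gradient field\<close>

lemma S_tilde_real: "Im (S_tilde u \<xi>) = 0"
proof -
  have "cnj (S_tilde u \<xi>) = S_tilde u \<xi>" by (simp add: S_tilde_def algebra_simps)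
  thus ?thesis by (simp add: complex_eq_iff)
qed

definition osc :: "real \<Rightarrow> complex \<Rightarrow> complex \<Rightarrow> complex" where
  "osc t u \<xi> = exp (\<i> * of_real t * S_tilde u \<xi>)"

lemma norm_osc [simp]: "norm (osc t u \<xi>) = 1"
  by (simp add: osc_def S_tilde_real)

lemma has_derivative_osc:
  assumes "\<xi> \<noteq> 0"
  shows "(osc t u has_derivative (\<lambda>v. osc t u \<xi> * (\<i> * of_real t * of_real (2 * Re (dS u \<xi> * v))))) (at \<xi>)"
  unfolding osc_def[abs_def]
  by (rule has_derivative_compose[OF has_derivative_mult_right[OF has_derivative_S_tilde[OF assms]]
        DERIV_exp[unfolded has_field_derivative_def]])

lemma borel_measurable_osc [measurable]: "osc t u \<in> borel_measurable borel"
proof -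
  have [measurable]: "cnj \<in> borel_measurable borel" "(exp :: complex \<Rightarrow> complex) \<in> borel_measurable borel"
    by (intro borel_measurable_continuous_onI continuous_intros)+
  show ?thesis unfolding osc_def[abs_def] S_tilde_def[abs_def] by measurable
qed

text \<open>The quotient rule, with \<open>k\<close> = 1/t in mind: the positive constant keeps the
  denominator away from 0, so the field stays differentiable at critical points of the
  phase.\<close>

lemma has_derivative_regularised_component:
  fixes P :: "'a::real_normed_vector \<Rightarrow> complex"
  assumes "(P has_derivative P') (at x)" "0 < k"
  shows "((\<lambda>x. Re (P x * v) / (k + (norm (P x))\<^sup>2)) has_derivative
     (\<lambda>w. Re (P' w * v) / (k + (norm (P x))\<^sup>2)
        - Re (P x * v) * (2 * (P x \<bullet> P' w)) / (k + (norm (P x))\<^sup>2)^2)) (at x)"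
proof -
  let ?Q = "k + (norm (P x))\<^sup>2"
  have Q: "?Q \<noteq> 0" using assms(2) zero_le_power2[of "norm (P x)"] by linarith
  have 1: "((\<lambda>x. Re (P x * v)) has_derivative (\<lambda>w. Re (P' w * v))) (at x)"
    by (intro has_derivative_Re has_derivative_mult_left assms)
  have 2: "((\<lambda>x. k + (norm (P x))\<^sup>2) has_derivative (\<lambda>w. 2 * (P x \<bullet> P' w))) (at x)"
    unfolding power2_norm_eq_inner
    by (auto intro!: derivative_eq_intros assms(1) simp: inner_commute)
  have "(a * ?Q - c * d) / (?Q * ?Q) = a / ?Q - c * d / ?Q\<^sup>2" for a c d
    using Q by (simp add: diff_divide_distrib power2_eq_square)
  with has_derivative_divide'[OF 1 2 Q] show ?thesis by simp
qed

text \<open>The terms of the derivative in direction \<open>v\<close> of \<open>b * osc t u * Re (dS u * v) / Q\<close> in which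
  the exponential is not differentiated, divided by \<open>osc t u\<close>.\<close>

definition slope_term :: "(complex \<Rightarrow> complex) \<Rightarrow> (complex \<Rightarrow> complex \<Rightarrow> complex) \<Rightarrow> real \<Rightarrow> complex \<Rightarrow> complex \<Rightarrow> complex \<Rightarrow> complex" where
  "slope_term b b' t u v \<xi> =
     (let p = dS u \<xi>; Q = 1 / t + (norm p)\<^sup>2 in
      b' \<xi> v * of_real (Re (p * v) / Q)
      + b \<xi> * of_real (Re (dS' \<xi> v * v) / Q - Re (p * v) * (2 * (p \<bullet> dS' \<xi> v)) / Q^2))"

text \<open>Up to the factor \<open>osc t u \<xi>\<close>, this is the amount by which the
  divergence of the regularised field falls short of 2 i t b. The first summand is the price of the
  1/t in the denominator.\<close>

definition remainder :: "(complex \<Rightarrow> complex) \<Rightarrow> (complex \<Rightarrow> complex \<Rightarrow> complex) \<Rightarrow> real \<Rightarrow> complex \<Rightarrow> complex \<Rightarrow> complex" where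
  "remainder b b' t u \<xi> = 2 * \<i> * b \<xi> / of_real (1 / t + (norm (dS u \<xi>))\<^sup>2)
     - slope_term b b' t u 1 \<xi> - slope_term b b' t u \<i> \<xi>"

text \<open>Amplitudes of order \<open>\<alpha>\<close> supported outside the open disc of radius
  \<open>R\<close>, with derivatives one order lower. The class contains both |\<xi>|^\<alpha>
  \<psi> and its products with the regularising factors, whose bounds can be kept independent of the
  scale \<delta>.\<close>

locale symbol =
  fixes R \<alpha> B :: real and b :: "complex \<Rightarrow> complex" and b' :: "complex \<Rightarrow> complex \<Rightarrow> complex"
  assumes R: "1 \<le> R" and \<alpha>: "0 \<le> \<alpha>" "\<alpha> < 1"
    and deriv: "\<And>\<xi>. (b has_derivative b' \<xi>) (at \<xi>)"
    and b_le: "\<And>\<xi>. R \<le> norm \<xi> \<Longrightarrow> norm (b \<xi>) \<le> B * norm \<xi> powr \<alpha>"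
    and b'_le: "\<And>\<xi> v. R \<le> norm \<xi> \<Longrightarrow> norm (b' \<xi> v) \<le> B * norm \<xi> powr (\<alpha> - 1) * norm v"
    and vanish: "\<And>\<xi>. norm \<xi> < R \<Longrightarrow> b \<xi> = 0"
begin

lemma B: "0 \<le> B"
proof -
  have "0 \<le> B * norm (of_real R :: complex) powr \<alpha>"
    using R by (intro order_trans[OF norm_ge_zero b_le]) auto
  thus ?thesis using R by (simp add: zero_le_mult_iff)
qed

lemma deriv_vanish:
  assumes "open S" "\<xi> \<in> S" "\<And>x. x \<in> S \<Longrightarrow> b x = 0"
  shows "b' \<xi> v = 0"
proof -
  have "((\<lambda>x. 0) has_derivative b' \<xi>) (at \<xi>)"
    by (rule has_derivative_transform_within_open[OF deriv assms(1,2)]) (simp add: assms(3))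
  from has_derivative_unique[OF this has_derivative_const] show ?thesis by (simp add: fun_eq_iff)
qed

lemma deriv_vanish_inside: "norm \<xi> < R \<Longrightarrow> b' \<xi> v = 0"
  by (rule deriv_vanish[of "ball 0 R"]) (auto intro: vanish)

text \<open>Differentiating the field costs 30 |\<xi>| / Q from the numerator and 60 |\<xi>| |p|^2 /
  Q^2 from the denominator. As |p|^2 \<le> Q, one power of Q cancels in the latter, and the sum is
  90 |\<xi>| / Q.\<close>

lemma slope_term_le:
  assumes t: "0 < t" and v: "norm v = 1" and \<xi>: "R \<le> norm \<xi>"
  shows "norm (slope_term b b' t u v \<xi>) \<le> 90 * B *
     ((norm \<xi> powr (\<alpha> - 1) * norm (dS u \<xi>) + norm \<xi> powr (\<alpha> + 1)) / (1 / t + norm (dS u \<xi>) ^ 2))"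
proof -
  define p Q n where "p = dS u \<xi>" and "Q = 1 / t + (norm p)\<^sup>2" and "n = norm \<xi>"
  have n: "1 \<le> n" using \<xi> R by (simp add: n_def)
  have Q: "0 < Q" "(norm p)\<^sup>2 \<le> Q" using t by (auto simp: Q_def add_pos_nonneg)
  have pv: "\<bar>Re (p * v)\<bar> \<le> norm p"
    using abs_Re_le_cmod[of "p * v"] v by (simp add: norm_mult)
  have d': "norm (dS' \<xi> v) \<le> 30 * n"
    using norm_dS'_le[of \<xi> v] n v by (simp add: n_def)
  have d'v: "\<bar>Re (dS' \<xi> v * v)\<bar> \<le> 30 * n"
    using abs_Re_le_cmod[of "dS' \<xi> v * v"] v d' by (simp add: norm_mult)
  have pd': "\<bar>p \<bullet> dS' \<xi> v\<bar> \<le> norm p * (30 * n)"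
    using Cauchy_Schwarz_ineq2[of p "dS' \<xi> v"] mult_left_mono[OF d', of "norm p"] by simp
  have 1: "norm (b' \<xi> v * of_real (Re (p * v) / Q)) \<le> B * (n powr (\<alpha> - 1) * norm p / Q)"
  proof -
    have "norm (b' \<xi> v * of_real (Re (p * v) / Q)) = norm (b' \<xi> v) * (\<bar>Re (p * v)\<bar> / Q)"
      using Q by (simp only: norm_mult norm_of_real abs_divide abs_of_pos)
    also have "\<dots> \<le> (B * n powr (\<alpha> - 1)) * (norm p / Q)"
      using Q B pv b'_le[OF \<xi>, of v] v by (intro mult_mono divide_right_mono) (auto simp: n_def)
    finally show ?thesis by simp
  qed
  have 2: "\<bar>Re (dS' \<xi> v * v) / Q - Re (p * v) * (2 * (p \<bullet> dS' \<xi> v)) / Q^2\<bar> \<le> 90 * n / Q"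
  proof -
    have "\<bar>Re (dS' \<xi> v * v) / Q\<bar> \<le> 30 * n / Q"
      using d'v Q by (simp add: abs_divide divide_right_mono)
    moreover have "\<bar>Re (p * v) * (2 * (p \<bullet> dS' \<xi> v)) / Q^2\<bar> \<le> 60 * n / Q"
    proof -
      have "\<bar>Re (p * v) * (2 * (p \<bullet> dS' \<xi> v)) / Q^2\<bar> = \<bar>Re (p * v)\<bar> * (2 * \<bar>p \<bullet> dS' \<xi> v\<bar>) / Q^2"
        by (simp add: abs_mult)
      also have "\<dots> \<le> norm p * (2 * (norm p * (30 * n))) / Q^2"
        using pv pd' n by (intro divide_right_mono mult_mono) auto
      also have "\<dots> = 60 * n * (norm p)\<^sup>2 / Q^2" by (simp add: power2_eq_square)
      also have "\<dots> \<le> 60 * n * Q / Q^2"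
        using Q n by (intro divide_right_mono mult_left_mono) auto
      also have "\<dots> = 60 * n / Q" using Q by (simp add: power2_eq_square)
      finally show ?thesis .
    qed
    moreover have "30 * n / Q + 60 * n / Q = 90 * n / Q" by (simp add: add_divide_distrib[symmetric])
    ultimately show ?thesis
      by (intro order_trans[OF abs_triangle_ineq4]) (metis add_mono)
  qed
  have 3: "norm (b \<xi> * of_real (Re (dS' \<xi> v * v) / Q - Re (p * v) * (2 * (p \<bullet> dS' \<xi> v)) / Q^2))
      \<le> 90 * B * (n powr (\<alpha> + 1) / Q)"
  proof -
    have "norm (b \<xi> * of_real (Re (dS' \<xi> v * v) / Q - Re (p * v) * (2 * (p \<bullet> dS' \<xi> v)) / Q^2))
        \<le> (B * n powr \<alpha>) * (90 * n / Q)"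
      unfolding norm_mult norm_of_real using B 2 b_le[OF \<xi>] by (intro mult_mono) (auto simp: n_def)
    also have "\<dots> = 90 * B * (n powr (\<alpha> + 1) / Q)"
      using n by (simp add: powr_add)
    finally show ?thesis .
  qed
  have "norm (slope_term b b' t u v \<xi>) \<le> B * (n powr (\<alpha> - 1) * norm p / Q) + 90 * B * (n powr (\<alpha> + 1) / Q)"
    unfolding slope_term_def Let_def p_def[symmetric] Q_def[symmetric]
    by (intro norm_triangle_le add_mono 1 3)
  also have "\<dots> \<le> 90 * B * (n powr (\<alpha> - 1) * norm p / Q) + 90 * B * (n powr (\<alpha> + 1) / Q)"
    using B Q by (intro add_mono mult_right_mono) auto
  also have "\<dots> = 90 * B * ((n powr (\<alpha> - 1) * norm p + n powr (\<alpha> + 1)) / Q)"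
    by (simp add: add_divide_distrib distrib_left)
  finally show ?thesis by (simp add: p_def Q_def n_def)
qed

text \<open>The two slope terms give 90 each and the regularisation term gives 2, using
  |\<xi>|^\<alpha> \<le> |\<xi>|^(\<alpha>+1) for |\<xi>| \<ge> 1.\<close>

lemma remainder_le:
  assumes t: "0 < t"
  shows "norm (remainder b b' t u \<xi>) \<le> 182 * B * majorant R \<alpha> t u \<xi>"
proof (cases "R \<le> norm \<xi>")
  case True
  let ?Q = "1 / t + (norm (dS u \<xi>))\<^sup>2"
  let ?m = "(norm \<xi> powr (\<alpha> - 1) * norm (dS u \<xi>) + norm \<xi> powr (\<alpha> + 1)) / ?Q"
  have Q: "0 < ?Q" using t by (simp add: add_pos_nonneg)
  have "norm (2 * \<i> * b \<xi> / of_real ?Q) = 2 * norm (b \<xi>) / ?Q"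
    using Q by (simp only: norm_mult norm_divide norm_of_real abs_of_pos) simp
  also have "\<dots> \<le> 2 * (B * norm \<xi> powr (\<alpha> + 1)) / ?Q"
  proof (intro divide_right_mono mult_left_mono order_trans[OF b_le[OF True]])
    show "norm \<xi> powr \<alpha> \<le> norm \<xi> powr (\<alpha> + 1)" using True R by (intro powr_mono) auto
  qed (use Q B in auto)
  also have "\<dots> = 2 * B * (norm \<xi> powr (\<alpha> + 1) / ?Q)" by simp
  also have "\<dots> \<le> 2 * B * ?m"
    using Q B by (intro mult_left_mono divide_right_mono) auto
  finally have 1: "norm (2 * \<i> * b \<xi> / of_real ?Q) \<le> 2 * B * ?m" .
  have "norm (remainder b b' t u \<xi>) \<le> norm (2 * \<i> * b \<xi> / of_real ?Q)
      + norm (slope_term b b' t u 1 \<xi>) + norm (slope_term b b' t u \<i> \<xi>)"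
    unfolding remainder_def by norm
  also have "\<dots> \<le> 2 * B * ?m + 90 * B * ?m + 90 * B * ?m"
    using t True by (intro add_mono 1 slope_term_le) auto
  finally show ?thesis using True by (simp add: majorant_def)
next
  case False
  thus ?thesis by (simp add: majorant_def remainder_def slope_term_def Let_def vanish deriv_vanish_inside)
qed

text \<open>Half the component in direction \<open>v\<close> of the amplitude times the exponential
  times the phase gradient, divided by Q = 1/t + |p|^2; only v = 1 and v = i are used.\<close>

definition flux :: "real \<Rightarrow> complex \<Rightarrow> complex \<Rightarrow> complex \<Rightarrow> complex" where
  "flux t u v \<xi> = b \<xi> * osc t u \<xi> * of_real (Re (dS u \<xi> * v) / (1 / t + (norm (dS u \<xi>))\<^sup>2))"

definition flux' :: "real \<Rightarrow> complex \<Rightarrow> complex \<Rightarrow> complex \<Rightarrow> complex \<Rightarrow> complex" where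
  "flux' t u v \<xi> w = osc t u \<xi> *
     (let p = dS u \<xi>; Q = 1 / t + (norm p)\<^sup>2 in
      b' \<xi> w * of_real (Re (p * v) / Q)
      + b \<xi> * of_real (Re (dS' \<xi> w * v) / Q - Re (p * v) * (2 * (p \<bullet> dS' \<xi> w)) / Q^2)
      + 2 * \<i> * of_real t * b \<xi> * of_real (Re (p * w) * Re (p * v) / Q))"

text \<open>For |\<xi>| < R, in particular at the singular point 0 of the phase, the flux vanishes
  identically; elsewhere the product rule applies.\<close>

lemma has_derivative_flux:
  assumes t: "0 < t"
  shows "(flux t u v has_derivative flux' t u v \<xi>) (at \<xi>)"
proof (cases "norm \<xi> < R")
  case True
  have "flux' t u v \<xi> = (\<lambda>w. 0)"
    using True by (simp add: flux'_def vanish deriv_vanish_inside fun_eq_iff Let_def)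
  moreover have "(flux t u v has_derivative (\<lambda>w. 0)) (at \<xi>)"
    by (rule has_derivative_transform_within_open[OF has_derivative_const[of 0] open_ball[of 0 R]])
      (use True in \<open>auto simp: flux_def vanish\<close>)
  ultimately show ?thesis by simp
next
  case False
  hence nz: "\<xi> \<noteq> 0" using R by auto
  have eq: "x * e * D + (x * (e * (\<i> * of_real t * of_real (2 * r))) + x' * e) * c
      = e * (x' * c + x * D + 2 * \<i> * of_real t * x * (of_real r * c))" for x e D r x' c
    by (simp add: algebra_simps)
  note comp = has_derivative_regularised_component[OF has_derivative_dS[OF nz, of u], of "1 / t" v]
  show ?thesis
    unfolding flux_def[abs_def]
    by (rule has_derivative_eq_rhs[OF has_derivative_mult[OF has_derivative_mult[OF deriv has_derivative_osc[OF nz]]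
          has_derivative_of_real[OF comp]]])
      (use t in \<open>simp_all only: fun_eq_iff flux'_def Let_def eq of_real_mult[symmetric] times_divide_eq_right zero_less_divide_iff zero_less_one simp_thms\<close>)
qed

lemma flux'_diag: "flux' t u v \<xi> v = osc t u \<xi> * (slope_term b b' t u v \<xi>
    + 2 * \<i> * of_real t * b \<xi> * of_real ((Re (dS u \<xi> * v))\<^sup>2 / (1 / t + (norm (dS u \<xi>))\<^sup>2)))"
  by (simp add: flux'_def slope_term_def Let_def power2_eq_square)

text \<open>The squares of Re p and Re (i p) add up to |p|^2 = Q - 1/t, so differentiating the
  exponential produces 2 i t b (1 - 1/(tQ)). The correction is the term 2 i b / Q of the
  remainder.\<close>

lemma flux'_divergence:
  assumes t: "0 < t"
  shows "flux' t u 1 \<xi> 1 + flux' t u \<i> \<xi> \<i> = osc t u \<xi> * (2 * \<i> * of_real t * b \<xi> - remainder b b' t u \<xi>)"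
proof -
  let ?p = "dS u \<xi>" and ?Q = "1 / t + (norm (dS u \<xi>))\<^sup>2"
  have Q: "0 < ?Q" using t by (simp add: add_pos_nonneg)
  have "(Re (?p * 1))\<^sup>2 + (Re (?p * \<i>))\<^sup>2 = ?Q - 1 / t"
    by (simp add: cmod_power2)
  hence "(Re (?p * 1))\<^sup>2 / ?Q + (Re (?p * \<i>))\<^sup>2 / ?Q = (?Q - 1 / t) / ?Q"
    by (simp only: add_divide_distrib[symmetric])
  also have "\<dots> = 1 - 1 / (t * ?Q)"
  proof -
    have "(Q - 1 / t) / Q = 1 - 1 / (t * Q)" if "0 < Q" for Q
      using that t by (simp add: diff_divide_distrib)
    thus ?thesis using Q by blast
  qed
  finally have "complex_of_real ((Re (?p * 1))\<^sup>2 / ?Q) + of_real ((Re (?p * \<i>))\<^sup>2 / ?Q) = of_real (1 - 1 / (t * ?Q))"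
    by (metis of_real_add)
  moreover have "2 * \<i> * of_real t * b \<xi> * of_real (1 - 1 / (t * ?Q))
      = 2 * \<i> * of_real t * b \<xi> - 2 * \<i> * b \<xi> / of_real ?Q"
    using t by (simp add: right_diff_distrib)
  ultimately have *: "2 * \<i> * of_real t * b \<xi> * complex_of_real ((Re (?p * 1))\<^sup>2 / ?Q)
      + 2 * \<i> * of_real t * b \<xi> * of_real ((Re (?p * \<i>))\<^sup>2 / ?Q)
      = 2 * \<i> * of_real t * b \<xi> - 2 * \<i> * b \<xi> / of_real ?Q"
    by (simp only: distrib_left[symmetric])
  have "e * (s + x) + e * (s' + y) = e * (z - (h - s - s'))" if "x + y = z - h" for e s s' x y z h :: complex
    using that by (metis (no_types, lifting) add.commute add.left_commute diff_diff_eq2 distrib_left diff_add_eq)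
  from this[OF *] show ?thesis
    unfolding flux'_diag remainder_def .
qed

end

context symbol begin

text \<open>A crude bound from 1/Q \<le> t and |p|/Q \<le> 1 + t. It may depend on \<open>r\<close>
  and \<open>t\<close>, since it only has to justify that the derivative integrates to 0.\<close>

lemma norm_flux'_le:
  assumes t: "0 < t" and v: "norm v = 1" and r: "0 \<le> r" and supp: "\<And>\<xi>. r < norm \<xi> \<Longrightarrow> b \<xi> = 0"
  shows "norm (flux' t u v \<xi> v) \<le> 90 * B * (1 + t + r\<^sup>2 * t) + 2 * t * (B * r)"
proof (cases "R \<le> norm \<xi> \<and> norm \<xi> \<le> r")
  case True
  define p Q n where "p = dS u \<xi>" and "Q = 1 / t + (norm p)\<^sup>2" and "n = norm \<xi>"
  have n: "1 \<le> n" "n \<le> r" "R \<le> norm \<xi>" using True R by (auto simp: n_def)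
  have Q: "0 < Q" "(norm p)\<^sup>2 \<le> Q" "1 / t \<le> Q" using t by (auto simp: Q_def add_pos_nonneg)
  have Qi: "1 / Q \<le> t" using Q t by (simp add: field_simps)
  have pQ: "norm p / Q \<le> 1 + t"
  proof -
    have "2 * norm p \<le> 1 + (norm p)\<^sup>2"
      using zero_le_power2[of "norm p - 1"] by (simp add: power2_eq_square algebra_simps)
    hence "norm p \<le> 1 + (norm p)\<^sup>2" using norm_ge_zero[of p] by linarith
    hence "norm p / Q \<le> (1 + Q) / Q" using Q by (intro divide_right_mono) auto
    also have "\<dots> = 1 / Q + 1" using Q by (simp add: add_divide_distrib)
    finally show ?thesis using Qi by linarith
  qed
  have pw: "n powr (\<alpha> - 1) \<le> 1" "n powr (\<alpha> + 1) \<le> r\<^sup>2" "n powr \<alpha> \<le> r"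
  proof -
    show "n powr (\<alpha> - 1) \<le> 1" using n \<alpha> powr_mono[of "\<alpha> - 1" 0 n] by simp
    have "n powr (\<alpha> + 1) \<le> n\<^sup>2" using n \<alpha> powr_mono[of "\<alpha> + 1" 2 n] by simp
    also have "\<dots> \<le> r\<^sup>2" using n by (intro power_mono) auto
    finally show "n powr (\<alpha> + 1) \<le> r\<^sup>2" .
    show "n powr \<alpha> \<le> r" using n \<alpha> powr_mono[of \<alpha> 1 n] by simp
  qed
  have "norm (slope_term b b' t u v \<xi>) \<le> 90 * B * ((n powr (\<alpha> - 1) * norm p + n powr (\<alpha> + 1)) / Q)"
    using slope_term_le[OF t v n(3), of u] by (simp add: n_def p_def Q_def)
  also have "(n powr (\<alpha> - 1) * norm p + n powr (\<alpha> + 1)) / Q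
      = n powr (\<alpha> - 1) * (norm p / Q) + n powr (\<alpha> + 1) * (1 / Q)"
    by (simp add: add_divide_distrib)
  also have "90 * B * \<dots> \<le> 90 * B * (1 * (1 + t) + r\<^sup>2 * t)"
    using pw pQ Qi Q B t by (intro mult_left_mono add_mono mult_mono) auto
  finally have 1: "norm (slope_term b b' t u v \<xi>) \<le> 90 * B * (1 + t + r\<^sup>2 * t)" by simp
  have "(Re (p * v))\<^sup>2 \<le> (norm (p * v))\<^sup>2"
    by (simp add: cmod_power2)
  also have "\<dots> \<le> Q" using v Q by (simp add: norm_mult)
  finally have re: "(Re (p * v))\<^sup>2 / Q \<le> 1" using Q by simp
  have "norm (2 * \<i> * of_real t * b \<xi> * complex_of_real ((Re (p * v))\<^sup>2 / Q)) = 2 * t * (norm (b \<xi>) * ((Re (p * v))\<^sup>2 / Q))"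
    unfolding norm_mult norm_of_real using t Q by simp
  also have "\<dots> \<le> 2 * t * ((B * n powr \<alpha>) * 1)"
    using t re Q B b_le[OF n(3)] by (intro mult_left_mono mult_mono) (auto simp: n_def)
  also have "\<dots> \<le> 2 * t * (B * r)"
    using t B pw by (simp add: mult_left_mono)
  finally have 2: "norm (2 * \<i> * of_real t * b \<xi> * complex_of_real ((Re (p * v))\<^sup>2 / Q)) \<le> 2 * t * (B * r)" .
  show ?thesis
    unfolding flux'_diag norm_mult[of "osc t u \<xi>"] norm_osc mult_1_left p_def[symmetric] Q_def[symmetric]
    by (intro norm_triangle_le add_mono 1 2)
next
  case False
  have "b \<xi> = 0 \<and> b' \<xi> v = 0"
  proof (cases "norm \<xi> < R")
    case False
    with \<open>\<not> (R \<le> norm \<xi> \<and> norm \<xi> \<le> r)\<close> have "r < norm \<xi>" by auto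
    moreover from this have "b' \<xi> v = 0"
      by (intro deriv_vanish[of "- cball 0 r"]) (auto intro: supp)
    ultimately show ?thesis using supp by blast
  qed (auto intro: vanish deriv_vanish_inside)
  thus ?thesis using B t r by (simp add: flux'_def Let_def)
qed

lemma continuous_b: "continuous_on UNIV b"
  by (auto intro!: continuous_at_imp_continuous_on has_derivative_continuous deriv)

text \<open>For a compactly supported symbol the divergence of the flux integrates to 0; the
  divergence identity then turns the oscillatory integral into that of the remainder and gains the
  factor 1/t.\<close>

lemma
  assumes t: "0 < t" and r: "0 \<le> r" and supp: "\<And>\<xi>. r < norm \<xi> \<Longrightarrow> b \<xi> = 0"
  shows integrable_oscillatory: "integrable lborel (\<lambda>\<xi>. b \<xi> * osc t u \<xi>)"
    and integrable_remainder: "integrable lborel (\<lambda>\<xi>. osc t u \<xi> * remainder b b' t u \<xi>)"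
    and integral_by_parts: "2 * \<i> * of_real t * (LINT \<xi>|lborel. b \<xi> * osc t u \<xi>)
        = (LINT \<xi>|lborel. osc t u \<xi> * remainder b b' t u \<xi>)"
proof -
  have b: "integrable lborel b"
    by (rule integrable_continuous_bounded_support[OF continuous_b supp])
  show int: "integrable lborel (\<lambda>\<xi>. b \<xi> * osc t u \<xi>)"
    by (rule Bochner_Integration.integrable_bound[OF b])
      (use borel_measurable_integrable[OF b] in \<open>auto simp: norm_mult\<close>)
  have flux0: "flux t u v \<xi> = 0" if "r < norm \<xi>" for v \<xi>
    using supp[OF that] by (simp add: flux_def)
  have i: "integrable lborel (\<lambda>\<xi>. flux' t u v \<xi> v)" "(LINT \<xi>|lborel. flux' t u v \<xi> v) = 0"
    if "norm v = 1" for v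
    using integral_directional_derivative_eq_0[OF has_derivative_flux[OF t] norm_flux'_le[OF t that r supp] flux0]
    by blast+
  have eq: "osc t u \<xi> * remainder b b' t u \<xi>
      = 2 * \<i> * of_real t * (b \<xi> * osc t u \<xi>) - (flux' t u 1 \<xi> 1 + flux' t u \<i> \<xi> \<i>)" for \<xi>
    unfolding flux'_divergence[OF t] by (simp add: algebra_simps)
  show "integrable lborel (\<lambda>\<xi>. osc t u \<xi> * remainder b b' t u \<xi>)"
    unfolding eq using int i by auto
  show "2 * \<i> * of_real t * (LINT \<xi>|lborel. b \<xi> * osc t u \<xi>)
        = (LINT \<xi>|lborel. osc t u \<xi> * remainder b b' t u \<xi>)"
    unfolding eq using int i by simp
qed

text \<open>The product rule. The bound on |\<xi>| |\<eta>'| is invariant under dilation, so one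
  \<open>D\<close> serves the factors \<phi>(\<delta> \<xi>) for all \<delta> > 0.\<close>

lemma mult_cutoff:
  assumes d: "\<And>\<xi>. (\<eta> has_derivative \<eta>' \<xi>) (at \<xi>)"
    and D: "\<And>\<xi>. norm (\<eta> \<xi>) \<le> D" "\<And>\<xi> v. norm \<xi> * norm (\<eta>' \<xi> v) \<le> D * norm v"
  shows "symbol R \<alpha> (2 * B * D) (\<lambda>\<xi>. b \<xi> * \<eta> \<xi>) (\<lambda>\<xi> v. b \<xi> * \<eta>' \<xi> v + b' \<xi> v * \<eta> \<xi>)"
proof
  have D0: "0 \<le> D" using D(1)[of 0] norm_ge_zero order_trans by blast
  show "1 \<le> R" "0 \<le> \<alpha>" "\<alpha> < 1" by (fact R \<alpha>)+
  show "((\<lambda>\<xi>. b \<xi> * \<eta> \<xi>) has_derivative (\<lambda>v. b \<xi> * \<eta>' \<xi> v + b' \<xi> v * \<eta> \<xi>)) (at \<xi>)" for \<xi>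
    by (rule has_derivative_mult[OF deriv d])
  show "b \<xi> * \<eta> \<xi> = 0" if "norm \<xi> < R" for \<xi> using vanish[OF that] by simp
  fix \<xi> :: complex assume \<xi>: "R \<le> norm \<xi>"
  have "norm (b \<xi> * \<eta> \<xi>) \<le> (B * norm \<xi> powr \<alpha>) * D"
    unfolding norm_mult using b_le[OF \<xi>] D B by (intro mult_mono) auto
  also have "\<dots> \<le> 2 * B * D * norm \<xi> powr \<alpha>" using B D0 by simp
  finally show "norm (b \<xi> * \<eta> \<xi>) \<le> 2 * B * D * norm \<xi> powr \<alpha>" .
  fix v :: complex
  have n: "0 < norm \<xi>" using \<xi> R by linarith
  have "norm (b \<xi> * \<eta>' \<xi> v) \<le> (B * norm \<xi> powr \<alpha>) * (D * norm v / norm \<xi>)"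
    unfolding norm_mult using b_le[OF \<xi>] D(2)[of \<xi> v] B n
    by (intro mult_mono) (auto simp: pos_le_divide_eq mult.commute)
  also have "\<dots> = B * D * norm \<xi> powr (\<alpha> - 1) * norm v"
    using n by (simp add: powr_diff)
  finally have 1: "norm (b \<xi> * \<eta>' \<xi> v) \<le> B * D * norm \<xi> powr (\<alpha> - 1) * norm v" .
  have "norm (b' \<xi> v * \<eta> \<xi>) \<le> (B * norm \<xi> powr (\<alpha> - 1) * norm v) * D"
    unfolding norm_mult using b'_le[OF \<xi>] D(1) B by (intro mult_mono) auto
  hence 2: "norm (b' \<xi> v * \<eta> \<xi>) \<le> B * D * norm \<xi> powr (\<alpha> - 1) * norm v" by (simp add: mult_ac)
  have "norm (b \<xi> * \<eta>' \<xi> v + b' \<xi> v * \<eta> \<xi>)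
      \<le> B * D * norm \<xi> powr (\<alpha> - 1) * norm v + B * D * norm \<xi> powr (\<alpha> - 1) * norm v"
    by (intro norm_triangle_le add_mono 1 2)
  thus "norm (b \<xi> * \<eta>' \<xi> v + b' \<xi> v * \<eta> \<xi>) \<le> 2 * B * D * norm \<xi> powr (\<alpha> - 1) * norm v"
    by (simp add: mult_ac)
qed

end

section \<open>Smooth cutoffs and the amplitude\<close>

lemma C_infinity_deriv:
  assumes "C_infinity f"
  shows "(f has_derivative frechet_derivative f (at x)) (at x)"
    and "continuous_on UNIV (\<lambda>x. frechet_derivative f (at x) v)"
proof -
  have *: "C_k (Suc 0) f" using assms by (simp add: C_infinity_def del: C_k.simps)
  thus "(f has_derivative frechet_derivative f (at x)) (at x)"
    by (simp add: frechet_derivative_works[symmetric])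
  show "continuous_on UNIV (\<lambda>x. frechet_derivative f (at x) v)" using * by simp
qed

text \<open>Beyond radius \<open>r\<close> the function is constant and its derivative is 0; on the
  closed ball continuity and compactness give bounds.\<close>

lemma C_infinity_cutoff_bounds:
  fixes f :: "complex \<Rightarrow> 'b::real_normed_vector"
  assumes f: "C_infinity f" and const: "\<And>x. r < norm x \<Longrightarrow> f x = c"
  shows "\<exists>D. (\<forall>x. norm (f x) \<le> D) \<and> (\<forall>x v. norm x * norm (frechet_derivative f (at x) v) \<le> D * norm v)"
proof -
  let ?f' = "\<lambda>x. frechet_derivative f (at x)"
  have zero: "?f' x v = 0" if "r < norm x" for x v
  proof -
    have "((\<lambda>x. c) has_derivative ?f' x) (at x)"
      by (rule has_derivative_transform_within_open[OF C_infinity_deriv(1)[OF f], of "- cball 0 r"])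
        (use that const in auto)
    from has_derivative_unique[OF this has_derivative_const] show ?thesis by (simp add: fun_eq_iff)
  qed
  have bdd: "\<exists>M\<ge>0. \<forall>x\<in>cball 0 r. norm (g x) \<le> M" if "continuous_on UNIV g" for g :: "complex \<Rightarrow> 'b"
  proof -
    have "bounded (g ` cball 0 r)"
      by (intro compact_imp_bounded compact_continuous_image continuous_on_subset[OF that]) auto
    thus ?thesis by (auto simp: bounded_pos intro: less_imp_le)
  qed
  have "continuous_on UNIV f"
    by (auto intro!: continuous_at_imp_continuous_on has_derivative_continuous C_infinity_deriv(1)[OF f])
  then obtain M where M: "0 \<le> M" "\<And>x. x \<in> cball 0 r \<Longrightarrow> norm (f x) \<le> M" using bdd by blast
  have "continuous_on UNIV (\<lambda>x. norm x *\<^sub>R ?f' x v)" for v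
    by (intro continuous_intros C_infinity_deriv(2)[OF f])
  hence "\<exists>M\<ge>0. \<forall>x\<in>cball 0 r. norm (norm x *\<^sub>R ?f' x v) \<le> M" for v by (rule bdd)
  hence "\<forall>v. \<exists>M. 0 \<le> M \<and> (\<forall>x\<in>cball 0 r. norm x * norm (?f' x v) \<le> M)" by simp
  then obtain N where N: "\<And>v. 0 \<le> N v" "\<And>v x. x \<in> cball 0 r \<Longrightarrow> norm x * norm (?f' x v) \<le> N v"
    unfolding choice_iff by blast
  have N': "norm x * norm (?f' x v) \<le> N v" for x v
    using N[of v] N(2)[of x v] zero[of x v] by (cases "r < norm x") auto
  \<comment> \<open>Continuity of the derivative is available for each fixed direction; linearity
    reduces an arbitrary direction to 1 and i.\<close>
  define D where "D = M + norm c + N 1 + N \<i>"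
  have "norm (f x) \<le> D" for x
  proof -
    have "norm (f x) \<le> M + norm c"
    proof (cases "r < norm x")
      case True
      thus ?thesis using const M(1) by simp
    next
      case False
      thus ?thesis using M(2)[of x] norm_ge_zero[of c] by (simp add: add_increasing2)
    qed
    thus ?thesis using N(1)[of 1] N(1)[of \<i>] unfolding D_def by linarith
  qed
  moreover have "norm x * norm (?f' x v) \<le> D * norm v" for x v
  proof -
    have lin: "linear (?f' x)" by (rule has_derivative_linear[OF C_infinity_deriv(1)[OF f]])
    have "v = Re v *\<^sub>R 1 + Im v *\<^sub>R \<i>" by (simp add: complex_eq_iff)
    hence "?f' x v = Re v *\<^sub>R ?f' x 1 + Im v *\<^sub>R ?f' x \<i>"
      by (metis linear_add[OF lin] linear_scale[OF lin])
    hence "norm (?f' x v) \<le> \<bar>Re v\<bar> * norm (?f' x 1) + \<bar>Im v\<bar> * norm (?f' x \<i>)"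
      by (metis norm_scaleR norm_triangle_ineq)
    also have "\<dots> \<le> norm v * norm (?f' x 1) + norm v * norm (?f' x \<i>)"
      by (intro add_mono mult_right_mono abs_Re_le_cmod abs_Im_le_cmod) auto
    finally have "norm x * norm (?f' x v) \<le> norm v * (norm x * norm (?f' x 1)) + norm v * (norm x * norm (?f' x \<i>))"
      by (metis (no_types, opaque_lifting) distrib_left mult.left_commute mult_left_mono norm_ge_zero)
    also have "\<dots> \<le> norm v * N 1 + norm v * N \<i>"
      by (intro add_mono mult_left_mono N') auto
    also have "\<dots> = (N 1 + N \<i>) * norm v" by (simp add: algebra_simps)
    also have "\<dots> \<le> D * norm v" using M(1) by (intro mult_right_mono) (auto simp: D_def)
    finally show ?thesis .
  qed
  ultimately show ?thesis by blast
qed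

text \<open>The cutoff removes the origin, where the power may fail to be smooth. Its derivative
  lives in the annulus between \<open>R\<close> and \<open>R + 1\<close>, so it is O(1/|\<xi>|) like
  that of a symbol of order 0, and the product rule gives one \<open>D\<close> for each
  factor.\<close>

lemma symbol_amplitude:
  assumes R: "1 \<le> R" and \<alpha>: "0 \<le> \<alpha>" "\<alpha> < 1" and \<psi>: "C_infinity \<psi>"
    "\<And>\<xi>. norm \<xi> \<le> R \<Longrightarrow> \<psi> \<xi> = 0" "\<And>\<xi>. norm \<xi> \<ge> R + 1 \<Longrightarrow> \<psi> \<xi> = 1"
  shows "\<exists>B a'. symbol R \<alpha> B (\<lambda>\<xi>. of_real (norm \<xi> powr \<alpha> * \<psi> \<xi>)) a'"
proof -
  let ?\<psi>' = "\<lambda>\<xi>. frechet_derivative \<psi> (at \<xi>)"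
  obtain D where D: "\<And>\<xi>. \<bar>\<psi> \<xi>\<bar> \<le> D" "\<And>\<xi> v. norm \<xi> * \<bar>?\<psi>' \<xi> v\<bar> \<le> D * norm v"
    using C_infinity_cutoff_bounds[of \<psi> "R + 1" 1] \<psi> by (auto simp: less_imp_le)
  have D0: "0 \<le> D" using D(1)[of 0] abs_ge_zero order_trans by blast
  have \<psi>'0: "?\<psi>' \<xi> v = 0" if "norm \<xi> < R" for \<xi> v
  proof -
    have "((\<lambda>x. 0) has_derivative ?\<psi>' \<xi>) (at \<xi>)"
      by (rule has_derivative_transform_within_open[OF C_infinity_deriv(1)[OF \<psi>(1)], of "ball 0 R"])
        (use that \<psi>(2) in auto)
    from has_derivative_unique[OF this has_derivative_const] show ?thesis by (simp add: fun_eq_iff)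
  qed
  define a' where "a' \<xi> v = complex_of_real
    (norm \<xi> powr \<alpha> * ?\<psi>' \<xi> v + norm \<xi> powr \<alpha> * ((sgn \<xi> \<bullet> v) * \<alpha> / norm \<xi>) * \<psi> \<xi>)" for \<xi> v
  have "symbol R \<alpha> (2 * D) (\<lambda>\<xi>. of_real (norm \<xi> powr \<alpha> * \<psi> \<xi>)) a'"
  proof
    show "1 \<le> R" "0 \<le> \<alpha>" "\<alpha> < 1" by fact+
    show "of_real (norm \<xi> powr \<alpha> * \<psi> \<xi>) = (0::complex)" if "norm \<xi> < R" for \<xi>
      using \<psi>(2)[of \<xi>] that by simp
    show "((\<lambda>\<xi>. complex_of_real (norm \<xi> powr \<alpha> * \<psi> \<xi>)) has_derivative a' \<xi>) (at \<xi>)" for \<xi>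
    proof (cases "norm \<xi> < R")
      case True
      hence "a' \<xi> = (\<lambda>v. 0)" using \<psi>'0 \<psi>(2)[of \<xi>] by (simp add: a'_def fun_eq_iff)
      moreover have "((\<lambda>\<xi>. complex_of_real (norm \<xi> powr \<alpha> * \<psi> \<xi>)) has_derivative (\<lambda>v. 0)) (at \<xi>)"
        by (rule has_derivative_transform_within_open[OF has_derivative_const[of 0] open_ball[of 0 R]])
          (use True \<psi>(2) in auto)
      ultimately show ?thesis by simp
    next
      case False
      hence nz: "\<xi> \<noteq> 0" "0 < norm \<xi>" using R by auto
      have "((\<lambda>\<xi>. norm \<xi> powr \<alpha>) has_derivative (\<lambda>v. norm \<xi> powr \<alpha> * ((sgn \<xi> \<bullet> v) * \<alpha> / norm \<xi>))) (at \<xi>)"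
        by (rule has_derivative_eq_rhs[OF has_derivative_powr[OF has_derivative_norm[OF nz(1)] has_derivative_const[of \<alpha>] nz(2)]])
          (simp_all add: inner_commute)
      from has_derivative_of_real[OF has_derivative_mult[OF this C_infinity_deriv(1)[OF \<psi>(1)]]]
      show ?thesis unfolding a'_def .
    qed
    fix \<xi> :: complex assume \<xi>: "R \<le> norm \<xi>"
    hence n: "0 < norm \<xi>" using R by linarith
    have "norm (complex_of_real (norm \<xi> powr \<alpha> * \<psi> \<xi>)) = norm \<xi> powr \<alpha> * \<bar>\<psi> \<xi>\<bar>"
      by (simp add: abs_mult norm_mult)
    also have "\<dots> \<le> norm \<xi> powr \<alpha> * D" by (intro mult_left_mono D) auto
    also have "\<dots> \<le> 2 * D * norm \<xi> powr \<alpha>" using D0 by simp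
    finally show "norm (complex_of_real (norm \<xi> powr \<alpha> * \<psi> \<xi>)) \<le> 2 * D * norm \<xi> powr \<alpha>" .
    fix v :: complex
    have pw: "norm \<xi> powr (\<alpha> - 1) = norm \<xi> powr \<alpha> / norm \<xi>" using n by (simp add: powr_diff)
    have 1: "\<bar>norm \<xi> powr \<alpha> * ?\<psi>' \<xi> v\<bar> \<le> D * norm \<xi> powr (\<alpha> - 1) * norm v"
    proof -
      have "\<bar>norm \<xi> powr \<alpha> * ?\<psi>' \<xi> v\<bar> = norm \<xi> powr \<alpha> * \<bar>?\<psi>' \<xi> v\<bar>"
        by (simp add: abs_mult)
      also have "\<dots> \<le> norm \<xi> powr \<alpha> * (D * norm v / norm \<xi>)"
        using D(2)[of \<xi> v] n by (intro mult_left_mono) (auto simp: pos_le_divide_eq mult.commute)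
      finally show ?thesis by (simp add: pw mult_ac)
    qed
    have 2: "\<bar>norm \<xi> powr \<alpha> * ((sgn \<xi> \<bullet> v) * \<alpha> / norm \<xi>) * \<psi> \<xi>\<bar> \<le> D * norm \<xi> powr (\<alpha> - 1) * norm v"
    proof -
      have "\<bar>sgn \<xi> \<bullet> v\<bar> \<le> norm v"
        using Cauchy_Schwarz_ineq2[of "sgn \<xi>" v] n by (simp add: norm_sgn)
      hence "\<bar>sgn \<xi> \<bullet> v\<bar> * \<alpha> * \<bar>\<psi> \<xi>\<bar> \<le> norm v * 1 * D"
        using \<alpha> D by (intro mult_mono) auto
      hence "norm \<xi> powr (\<alpha> - 1) * (\<bar>sgn \<xi> \<bullet> v\<bar> * \<alpha> * \<bar>\<psi> \<xi>\<bar>) \<le> norm \<xi> powr (\<alpha> - 1) * (norm v * 1 * D)"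
        by (rule mult_left_mono) auto
      thus ?thesis using \<alpha> by (simp add: abs_mult pw mult_ac)
    qed
    have "norm (a' \<xi> v) \<le> D * norm \<xi> powr (\<alpha> - 1) * norm v + D * norm \<xi> powr (\<alpha> - 1) * norm v"
      unfolding a'_def norm_of_real by (intro order_trans[OF abs_triangle_ineq] add_mono 1 2)
    thus "norm (a' \<xi> v) \<le> 2 * D * norm \<xi> powr (\<alpha> - 1) * norm v" by (simp add: mult_ac)
  qed
  thus ?thesis by blast
qed

section \<open>Test functions and removal of the regularisation\<close>

lemma test_function_bounds:
  assumes "test_function \<phi>"
  obtains r D where "0 \<le> r" "\<And>\<xi>. r < norm \<xi> \<Longrightarrow> \<phi> \<xi> = 0" "\<And>\<xi>. norm (\<phi> \<xi>) \<le> D"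
    "\<And>\<xi> v. norm \<xi> * norm (frechet_derivative \<phi> (at \<xi>) v) \<le> D * norm v"
proof -
  have "bounded (closure {\<xi>. \<phi> \<xi> \<noteq> 0})"
    using assms by (auto simp: test_function_def intro: compact_imp_bounded)
  then obtain r where r: "0 < r" "\<And>\<xi>. \<xi> \<in> closure {\<xi>. \<phi> \<xi> \<noteq> 0} \<Longrightarrow> norm \<xi> \<le> r"
    by (auto simp: bounded_pos)
  have supp: "\<phi> \<xi> = 0" if "r < norm \<xi>" for \<xi>
    using r(2)[of \<xi>] that closure_subset[of "{\<xi>. \<phi> \<xi> \<noteq> 0}"] by force
  obtain D where "\<forall>\<xi>. norm (\<phi> \<xi>) \<le> D" "\<forall>\<xi> v. norm \<xi> * norm (frechet_derivative \<phi> (at \<xi>) v) \<le> D * norm v"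
    using C_infinity_cutoff_bounds[of \<phi> r 0] supp assms by (auto simp: test_function_def)
  thus thesis using that[of r D] r(1) supp by auto
qed

text \<open>Integration by parts is done for each regularised symbol, which has compact support. The
  remainders are dominated by one multiple of the majorant, uniformly in \<delta>, so \<delta> can
  tend to 0 under the integral, and the limit does not depend on \<phi>.\<close>

lemma (in symbol)
  assumes t: "0 < t" and maj: "integrable lborel (majorant R \<alpha> t u)"
  shows has_oscillatory_integral_symbol: "has_oscillatory_integral (\<lambda>\<xi>. b \<xi> * osc t u \<xi>)
      ((LINT \<xi>|lborel. osc t u \<xi> * remainder b b' t u \<xi>) / (2 * \<i> * of_real t))"
    (is "has_oscillatory_integral _ ?I")
  unfolding has_oscillatory_integral_def
proof (intro allI impI conjI)
  fix \<phi> :: "complex \<Rightarrow> complex" assume \<phi>: "test_function \<phi> \<and> \<phi> 0 = 1"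
  let ?\<phi>' = "\<lambda>\<xi>. frechet_derivative \<phi> (at \<xi>)"
  have C: "C_infinity \<phi>" using \<phi> by (simp add: test_function_def)
  note d = C_infinity_deriv(1)[OF C]
  obtain r D where r: "0 \<le> r" "\<And>\<xi>. r < norm \<xi> \<Longrightarrow> \<phi> \<xi> = 0" and D: "\<And>\<xi>. norm (\<phi> \<xi>) \<le> D"
    "\<And>\<xi> v. norm \<xi> * norm (?\<phi>' \<xi> v) \<le> D * norm v"
    using test_function_bounds \<phi> by blast
  define c where "c \<delta> \<xi> = b \<xi> * \<phi> (\<delta> *\<^sub>R \<xi>)" for \<delta> \<xi>
  define c' where "c' \<delta> \<xi> v = b \<xi> * ?\<phi>' (\<delta> *\<^sub>R \<xi>) (\<delta> *\<^sub>R v) + b' \<xi> v * \<phi> (\<delta> *\<^sub>R \<xi>)" for \<delta> \<xi> v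
  have sym: "symbol R \<alpha> (2 * B * D) (c \<delta>) (c' \<delta>)" if "0 < \<delta>" for \<delta>
    unfolding c_def c'_def
  proof (rule mult_cutoff)
    fix \<xi> :: complex
    show "((\<lambda>\<xi>. \<phi> (\<delta> *\<^sub>R \<xi>)) has_derivative (\<lambda>v. ?\<phi>' (\<delta> *\<^sub>R \<xi>) (\<delta> *\<^sub>R v))) (at \<xi>)"
      by (rule has_derivative_compose[OF _ d]) (auto intro!: derivative_eq_intros)
    show "norm (\<phi> (\<delta> *\<^sub>R \<xi>)) \<le> D" by (rule D)
    fix v
    show "norm \<xi> * norm (?\<phi>' (\<delta> *\<^sub>R \<xi>) (\<delta> *\<^sub>R v)) \<le> D * norm v"
      using D(2)[of "\<delta> *\<^sub>R \<xi>" v] that by (simp add: linear_scale[OF has_derivative_linear[OF d]] mult_ac)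
  qed
  have supp: "c \<delta> \<xi> = 0" if "0 < \<delta>" "r / \<delta> < norm \<xi>" for \<delta> \<xi>
  proof -
    have "r < norm (\<delta> *\<^sub>R \<xi>)" using that by (simp add: pos_divide_less_eq mult.commute)
    thus ?thesis by (simp add: c_def r(2))
  qed
  have r': "0 \<le> r / \<delta>" if "0 < \<delta>" for \<delta> using that r by simp
  have eq: "b \<xi> * osc t u \<xi> * \<phi> (\<delta> *\<^sub>R \<xi>) = c \<delta> \<xi> * osc t u \<xi>" for \<delta> \<xi> by (simp add: c_def)
  show "integrable lborel (\<lambda>\<xi>. b \<xi> * osc t u \<xi> * \<phi> (\<delta> *\<^sub>R \<xi>))" if "0 < \<delta>" for \<delta>
    unfolding eq by (rule symbol.integrable_oscillatory[OF sym[OF that] t r'[OF that] supp[OF that]])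
  have parts: "(LINT \<xi>|lborel. b \<xi> * osc t u \<xi> * \<phi> (\<delta> *\<^sub>R \<xi>))
      = (LINT \<xi>|lborel. osc t u \<xi> * remainder (c \<delta>) (c' \<delta>) t u \<xi>) / (2 * \<i> * of_real t)" if "0 < \<delta>" for \<delta>
    using symbol.integral_by_parts[OF sym[OF that] t r'[OF that] supp[OF that], of u] t
    unfolding eq by (simp add: field_simps)
  show "((\<lambda>\<delta>. LINT \<xi>|lborel. b \<xi> * osc t u \<xi> * \<phi> (\<delta> *\<^sub>R \<xi>)) \<longlongrightarrow> ?I) (at_right 0)"
  \<comment> \<open>Dominated convergence is sequential, so the limit from the right is tested along
    sequences.\<close>
  proof (rule tendsto_at_right_sequentially[of 0 1])
    fix S :: "nat \<Rightarrow> real" assume S: "\<And>n. 0 < S n" "S \<longlonglongrightarrow> 0"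
    have S\<xi>: "(\<lambda>n. S n *\<^sub>R \<xi>) \<longlonglongrightarrow> 0" for \<xi> :: complex
      using tendsto_scaleR[OF S(2) tendsto_const[of \<xi>]] by simp
    have "isCont \<phi> 0" using has_derivative_continuous[OF d[of 0]] .
    hence \<phi>_lim: "(\<lambda>n. \<phi> (S n *\<^sub>R \<xi>)) \<longlonglongrightarrow> 1" for \<xi>
      using isCont_tendsto_compose[OF _ S\<xi>, of \<phi>] \<phi> by auto
    hence c_lim: "(\<lambda>n. c (S n) \<xi>) \<longlonglongrightarrow> b \<xi>" for \<xi>
      unfolding c_def using tendsto_mult[OF tendsto_const[of "b \<xi>"]] by fastforce
    \<comment> \<open>The chain rule puts a factor \<open>S n\<close> in front of the derivative of
      the cutoff, which kills that term in the limit.\<close>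
    have c'_lim: "(\<lambda>n. c' (S n) \<xi> v) \<longlonglongrightarrow> b' \<xi> v" for \<xi> v
    proof -
      have "isCont (\<lambda>x. ?\<phi>' x v) 0"
        using C_infinity_deriv(2)[OF C] by (simp add: continuous_on_eq_continuous_at)
      hence "(\<lambda>n. ?\<phi>' (S n *\<^sub>R \<xi>) v) \<longlonglongrightarrow> ?\<phi>' 0 v" by (rule isCont_tendsto_compose[OF _ S\<xi>])
      from tendsto_scaleR[OF S(2) this] have "(\<lambda>n. ?\<phi>' (S n *\<^sub>R \<xi>) (S n *\<^sub>R v)) \<longlonglongrightarrow> 0"
        by (simp add: linear_scale[OF has_derivative_linear[OF d]])
      hence "(\<lambda>n. c' (S n) \<xi> v) \<longlonglongrightarrow> b \<xi> * 0 + b' \<xi> v * 1"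
        unfolding c'_def by (intro tendsto_intros \<phi>_lim)
      thus ?thesis by simp
    qed
    have lim: "(\<lambda>n. osc t u \<xi> * remainder (c (S n)) (c' (S n)) t u \<xi>) \<longlonglongrightarrow> osc t u \<xi> * remainder b b' t u \<xi>" for \<xi>
    proof -
      have "complex_of_real (1 / t + (norm (dS u \<xi>))\<^sup>2) \<noteq> 0"
        using t by (metis add_pos_nonneg less_irrefl of_real_eq_0_iff zero_le_power2 zero_less_divide_1_iff)
      thus ?thesis unfolding remainder_def slope_term_def Let_def
        by (intro tendsto_intros c_lim c'_lim)
    qed
    have meas: "(\<lambda>\<xi>. osc t u \<xi> * remainder (c (S n)) (c' (S n)) t u \<xi>) \<in> borel_measurable lborel" for n
      by (rule borel_measurable_integrable[OF symbol.integrable_remainder[OF sym[OF S(1)] t r'[OF S(1)] supp[OF S(1)]]])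
    have "(\<lambda>n. LINT \<xi>|lborel. osc t u \<xi> * remainder (c (S n)) (c' (S n)) t u \<xi>)
        \<longlonglongrightarrow> (LINT \<xi>|lborel. osc t u \<xi> * remainder b b' t u \<xi>)"
    proof (rule integral_dominated_convergence[where w = "\<lambda>\<xi>. 182 * (2 * B * D) * majorant R \<alpha> t u \<xi>"])
      show "(\<lambda>\<xi>. osc t u \<xi> * remainder b b' t u \<xi>) \<in> borel_measurable lborel"
        by (rule borel_measurable_LIMSEQ_metric[OF meas lim])
      show "AE \<xi> in lborel. norm (osc t u \<xi> * remainder (c (S n)) (c' (S n)) t u \<xi>)
          \<le> 182 * (2 * B * D) * majorant R \<alpha> t u \<xi>" for n
        using symbol.remainder_le[OF sym[OF S(1)] t] by (simp add: norm_mult)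
    qed (use meas lim maj in auto)
    hence "(\<lambda>n. (LINT \<xi>|lborel. osc t u \<xi> * remainder (c (S n)) (c' (S n)) t u \<xi>) / (2 * \<i> * of_real t)) \<longlonglongrightarrow> ?I"
      using t by (intro tendsto_intros) auto
    thus "(\<lambda>n. LINT \<xi>|lborel. b \<xi> * osc t u \<xi> * \<phi> (S n *\<^sub>R \<xi>)) \<longlonglongrightarrow> ?I"
      by (simp only: parts[OF S(1)])
  qed simp
qed

lemma (in symbol) norm_oscillatory_integral_le:
  assumes t: "0 < t" and maj: "integrable lborel (majorant R \<alpha> t u)"
  shows "norm ((LINT \<xi>|lborel. osc t u \<xi> * remainder b b' t u \<xi>) / (2 * \<i> * of_real t))
     \<le> 91 * B * integral\<^sup>L lborel (majorant R \<alpha> t u) / t"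
proof -
  let ?f = "\<lambda>\<xi>. osc t u \<xi> * remainder b b' t u \<xi>"
  have "norm (LINT \<xi>|lborel. ?f \<xi>) \<le> (LINT \<xi>|lborel. 182 * B * majorant R \<alpha> t u \<xi>)"
  proof (cases "integrable lborel ?f")
    case True
    thus ?thesis
      using remainder_le[OF t] maj
      by (intro Bochner_Integration.integral_norm_bound_integral) (auto simp: norm_mult)
  next
    \<comment> \<open>The integral of a non-integrable function is 0 by convention, and the majorant
      is nonnegative.\<close>
    case False
    have "0 \<le> majorant R \<alpha> t u \<xi>" for \<xi> using t by (simp add: majorant_def)
    thus ?thesis using B by (simp add: not_integrable_integral_eq[OF False])
  qed
  thus ?thesis using t by (simp add: norm_divide norm_mult field_simps)
qed

section \<open>Uniqueness of the oscillatory integral and the estimate\<close>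

lemma C_k_affine:
  assumes "bounded_linear L" "C_k k f"
  shows "C_k k (\<lambda>x. c + L (f x))"
  using assms(2)
proof (induction k arbitrary: f c)
  case 0
  thus ?case
    by (simp add: continuous_on_add bounded_linear.continuous_on[OF assms(1)])
next
  case (Suc k)
  \<comment> \<open>The summand 0 is kept so that the derivative has the shape of the induction
    hypothesis with c = 0.\<close>
  have d: "((\<lambda>x. c + L (f x)) has_derivative (\<lambda>v. 0 + L (frechet_derivative f (at x) v))) (at x)" for x
    using Suc.prems by (intro has_derivative_add has_derivative_const bounded_linear.has_derivative[OF assms(1)])
      (simp add: frechet_derivative_works[symmetric])
  have "frechet_derivative (\<lambda>x. c + L (f x)) (at x) = (\<lambda>v. 0 + L (frechet_derivative f (at x) v))" for x
    by (rule frechet_derivative_at[OF d, symmetric])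
  moreover have "C_k k (\<lambda>x. 0 + L (frechet_derivative f (at x) v))" for v
    using Suc.prems by (intro Suc.IH) simp
  ultimately show ?case using d by (auto simp: differentiable_def)
qed

text \<open>The given cutoff provides a test function with value 1 at the origin. Some such function
  must exist for the oscillatory integral to be unique, as otherwise its defining condition would
  hold vacuously for every value.\<close>

lemma test_function_complement:
  assumes "C_infinity \<psi>" "\<And>\<xi>. norm \<xi> \<ge> r \<Longrightarrow> \<psi> \<xi> = 1"
  shows "test_function (\<lambda>\<xi>. complex_of_real (1 - \<psi> \<xi>))"
  unfolding test_function_def
proof
  have "C_k k (\<lambda>\<xi>. 1 + (\<lambda>x. complex_of_real (- x)) (\<psi> \<xi>))" for k
  proof (rule C_k_affine[where f = \<psi>])
    show "bounded_linear (\<lambda>x. complex_of_real (- x))"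
      by (intro bounded_linear_compose[OF bounded_linear_of_real] bounded_linear_minus bounded_linear_ident)
    show "C_k k \<psi>" using assms(1) by (simp add: C_infinity_def)
  qed
  thus "C_infinity (\<lambda>\<xi>. complex_of_real (1 - \<psi> \<xi>))" by (simp add: C_infinity_def)
  have "{\<xi>. complex_of_real (1 - \<psi> \<xi>) \<noteq> 0} \<subseteq> cball 0 r"
    using assms(2) by (auto simp: not_le[symmetric] intro: ccontr)
  thus "compact (closure {\<xi>. complex_of_real (1 - \<psi> \<xi>) \<noteq> 0})"
    by (meson bounded_cball bounded_subset compact_closure)
qed

lemma has_oscillatory_integral_unique:
  assumes "test_function \<phi>" "\<phi> 0 = 1" "has_oscillatory_integral f I" "has_oscillatory_integral f J"
  shows "I = J"
proof -
  have "((\<lambda>\<delta>. LINT \<xi>|lborel. f \<xi> * \<phi> (\<delta> *\<^sub>R \<xi>)) \<longlongrightarrow> K) (at_right 0)"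
    if "has_oscillatory_integral f K" for K
    using that assms(1,2) by (simp add: has_oscillatory_integral_def)
  from this[OF assms(3)] this[OF assms(4)] show ?thesis
    by (rule tendsto_unique[OF trivial_limit_at_right_real])
qed

theorem proposition2p2:
  fixes R \<alpha> :: real and \<psi> :: "complex \<Rightarrow> real"
  assumes "R > 2"
    and "C_infinity \<psi>"
    and "\<And>\<xi>. 0 \<le> \<psi> \<xi> \<and> \<psi> \<xi> \<le> 1"
    and "\<And>\<xi>. norm \<xi> \<le> R \<Longrightarrow> \<psi> \<xi> = 0"
    and "\<And>\<xi>. norm \<xi> \<ge> R + 1 \<Longrightarrow> \<psi> \<xi> = 1"
    and "0 \<le> \<alpha>" "\<alpha> < 1"
  shows "\<exists>\<epsilon>\<^sub>0>0. \<forall>\<epsilon>. 0 < \<epsilon> \<and> \<epsilon> < \<epsilon>\<^sub>0 \<longrightarrow>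
           (\<exists>C>0. \<forall>t>0. \<forall>u.
              oscillatory_integrable (integrand_I \<psi> \<alpha> t u) \<and>
              norm (oscillatory_integral (integrand_I \<psi> \<alpha> t u)) \<le> C * (1 / t powr (1 - \<epsilon>)))"
\<comment> \<open>The threshold below which the envelope decays fast enough to be integrable at
  infinity.\<close>
proof (rule exI[of _ "(1 - \<alpha>) / 4"], intro conjI allI impI)
  show "0 < (1 - \<alpha>) / 4" using assms(7) by simp
  fix \<epsilon> :: real assume \<epsilon>: "0 < \<epsilon> \<and> \<epsilon> < (1 - \<alpha>) / 4"
  let ?a = "\<lambda>\<xi>. complex_of_real (norm \<xi> powr \<alpha> * \<psi> \<xi>)"
  obtain B a' where "symbol R \<alpha> B ?a a'"
    using symbol_amplitude[of R \<alpha> \<psi>] assms by auto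
  then interpret symbol R \<alpha> B ?a a' .
  obtain C where C: "0 \<le> C" "\<And>t u. 0 < t \<Longrightarrow> integrable lborel (majorant R \<alpha> t u)"
      "\<And>t u. 0 < t \<Longrightarrow> integral\<^sup>L lborel (majorant R \<alpha> t u) \<le> C * t powr \<epsilon>"
    using majorant_integral_le[of R \<alpha> \<epsilon>] assms \<epsilon> by blast
  have test: "test_function (\<lambda>\<xi>. complex_of_real (1 - \<psi> \<xi>))"
    by (rule test_function_complement[of \<psi> "R + 1"]) (use assms in auto)
  have test0: "complex_of_real (1 - \<psi> 0) = 1" using assms(1,4) by simp
  \<comment> \<open>The summand 1 makes the constant positive even when \<open>B\<close> or
    \<open>C\<close> is 0.\<close>
  have "oscillatory_integrable (integrand_I \<psi> \<alpha> t u) \<and>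
      norm (oscillatory_integral (integrand_I \<psi> \<alpha> t u)) \<le> (91 * B * C + 1) * (1 / t powr (1 - \<epsilon>))"
    if t: "0 < t" for t u
  proof -
    let ?I = "(LINT \<xi>|lborel. osc t u \<xi> * remainder ?a a' t u \<xi>) / (2 * \<i> * of_real t)"
    have "integrand_I \<psi> \<alpha> t u = (\<lambda>\<xi>. ?a \<xi> * osc t u \<xi>)"
      by (simp add: integrand_I_def osc_def fun_eq_iff)
    hence I: "has_oscillatory_integral (integrand_I \<psi> \<alpha> t u) ?I"
      using has_oscillatory_integral_symbol[OF t C(2)[OF t]] by simp
    have "oscillatory_integral (integrand_I \<psi> \<alpha> t u) = ?I"
      unfolding oscillatory_integral_def
    proof (rule the_equality[where P = "has_oscillatory_integral (integrand_I \<psi> \<alpha> t u)", OF I])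
      fix J assume "has_oscillatory_integral (integrand_I \<psi> \<alpha> t u) J"
      from has_oscillatory_integral_unique[OF test test0 this I] show "J = ?I" .
    qed
    moreover have "norm ?I \<le> (91 * B * C + 1) * (1 / t powr (1 - \<epsilon>))"
    proof -
      have "norm ?I \<le> 91 * B * integral\<^sup>L lborel (majorant R \<alpha> t u) / t"
        by (rule norm_oscillatory_integral_le[OF t C(2)[OF t]])
      also have "\<dots> \<le> 91 * B * (C * t powr \<epsilon>) / t"
        using B t by (intro divide_right_mono mult_left_mono C) auto
      also have "\<dots> = 91 * B * C * (1 / t powr (1 - \<epsilon>))"
        using t by (simp add: powr_diff)
      also have "\<dots> \<le> (91 * B * C + 1) * (1 / t powr (1 - \<epsilon>))"
        by (intro mult_right_mono) auto
      finally show ?thesis .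
    qed
    ultimately show ?thesis using I by (auto simp: oscillatory_integrable_def)
  qed
  moreover have "0 < 91 * B * C + 1" using B C(1) by (simp add: add_nonneg_pos)
  ultimately show "\<exists>C>0. \<forall>t>0. \<forall>u. oscillatory_integrable (integrand_I \<psi> \<alpha> t u) \<and>
      norm (oscillatory_integral (integrand_I \<psi> \<alpha> t u)) \<le> C * (1 / t powr (1 - \<epsilon>))"
    by blast
qed

end
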